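(* Let $X$ and $Y$ be uniformly locally finite metric spaces. Then every isomorphism $\Phi\colon\mathrm{C}^*(X)\to\mathrm{C}^*(Y)$ is coarse-like; that is, for all $\varepsilon,r>0$ there is $s>0$ so that for every contraction $a\in\mathrm{C}^*(X)$ with $\mathrm{prop}(a)\leq r$ there is $c\in\mathrm{C}^*(Y)$ with $\mathrm{prop}(c)\leq s$ and $\|\Phi(a)-c\|\leq\varepsilon$.
   Context: A metric space $(X,d)$ is uniformly locally finite (u.l.f.) if $\sup_{x\in X}|B_r(x)|<\infty$ for all $r>0$, where $B_r(x)$ is the closed ball of radius $r$ centered at $x$. $H$ is a separable infinite-dimensional Hilbert space. $\ell_2(X,H)$ is the Hilbert space of square-summable functions $X\to H$, and $\delta_x\otimes\eta$ is the function with value $\eta$ at $x$ and $0$ elsewhere. For $a\in\mathcal B(\ell_2(X,H))$ and $x,y\in X$, $a_{xy}\in\mathcal B(H)$ is determined by $\langle a_{xy}\xi,\eta\rangle=\langle a(\delta_x\otimes\xi),\delta_y\otimes\eta\rangle$, and $\mathrm{prop}(a)=\sup\{d(x,y)\mid a_{xy}\neq 0\}$. $\mathrm{BD}(X)$ is the norm closure of $\{a\in\mathcal B(\ell_2(X,H))\mid\mathrm{prop}(a)<\infty\}$, and the Roe algebra is $\mathrm{C}^*(X)=\{a\in \mathrm{BD}(X)\mid a_{xy}\text{ is compact for all }x,y\in X\}$. Isomorphism means $^*$-isomorphism of C$^*$-algebras. *)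

theory Defs
  imports "HOL-Analysis.Analysis"
begin

section \<open>Complex Hilbert spaces\<close>

class scaleC =
  fixes scaleC :: "complex \<Rightarrow> 'a \<Rightarrow> 'a"  (infixr \<open>*\<^sub>C\<close> 75)

class complex_vector = scaleC + real_vector +
  assumes scaleC_add_right: "c *\<^sub>C (x + y) = c *\<^sub>C x + c *\<^sub>C y"
    and scaleC_add_left: "(c + d) *\<^sub>C x = c *\<^sub>C x + d *\<^sub>C x"
    and scaleC_scaleC: "c *\<^sub>C (d *\<^sub>C x) = (c * d) *\<^sub>C x"
    and scaleC_one: "1 *\<^sub>C x = x"
    and scaleR_scaleC: "r *\<^sub>R x = complex_of_real r *\<^sub>C x"

global_interpretation complex_vector:
  vector_space "scaleC :: complex \<Rightarrow> 'a \<Rightarrow> 'a :: complex_vector"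
  by unfold_locales (fact scaleC_add_right scaleC_add_left scaleC_scaleC scaleC_one)+

class complex_normed_vector = complex_vector + real_normed_vector +
  assumes norm_scaleC: "norm (c *\<^sub>C x) = cmod c * norm x"

text \<open>Inner products are linear in the first variable. The underlying real inner product is the
  real part, so that the norm satisfies \<open>norm x = sqrt (Re (cinner x x))\<close>.\<close>

class complex_inner = complex_vector + real_inner +
  fixes cinner :: "'a \<Rightarrow> 'a \<Rightarrow> complex"
  assumes cinner_commute: "cinner x y = cnj (cinner y x)"
    and cinner_add_left: "cinner (x + y) z = cinner x z + cinner y z"
    and cinner_scaleC_left: "cinner (c *\<^sub>C x) y = c * cinner x y"
    and inner_eq_Re_cinner: "inner x y = Re (cinner x y)"

class chilbert_space = complex_inner + complete_space

lemma cinner_add_right: "cinner x (y + z) = cinner x y + cinner x z"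
  by (metis cinner_add_left cinner_commute complex_cnj_add)

lemma cinner_scaleC_right: "cinner x (c *\<^sub>C y) = cnj c * cinner x y"
  by (metis cinner_scaleC_left cinner_commute complex_cnj_mult)

lemma cinner_self: "cinner x x = complex_of_real ((norm x)\<^sup>2)"
proof -
  have "Im (cinner x x) = 0"
    using cinner_commute[of x x] by (metis cnj.simps(2) neg_equal_zero)
  moreover have "Re (cinner x x) = (norm x)\<^sup>2"
    by (simp add: power2_norm_eq_inner inner_eq_Re_cinner)
  ultimately show ?thesis
    by (simp add: complex_eq_iff)
qed

lemma cinner_zero_left [simp]: "cinner 0 y = 0"
  using cinner_scaleC_left[of 0 0 y] by simp

lemma cinner_zero_right [simp]: "cinner x 0 = 0"
  using cinner_commute[of x 0] by simp

lemma cinner_diff_left: "cinner (x - y) z = cinner x z - cinner y z"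
  by (metis add_diff_cancel_right' cinner_add_left diff_add_cancel)

lemma cinner_ext: "(\<And>z. cinner x z = cinner y z) \<Longrightarrow> x = y"
  using cinner_self[of "x - y"] by (simp add: cinner_diff_left)

instance complex_inner \<subseteq> complex_normed_vector
proof
  fix c :: complex and x :: 'a
  have "complex_of_real ((norm (c *\<^sub>C x))\<^sup>2) = c * cnj c * complex_of_real ((norm x)\<^sup>2)"
    by (simp only: cinner_self[symmetric] cinner_scaleC_left cinner_scaleC_right mult_ac)
  also have "\<dots> = complex_of_real ((cmod c * norm x)\<^sup>2)"
    by (simp only: power_mult_distrib of_real_mult complex_norm_square)
  finally have "(norm (c *\<^sub>C x))\<^sup>2 = (cmod c * norm x)\<^sup>2"
    by (simp only: of_real_eq_iff)
  then show "norm (c *\<^sub>C x) = cmod c * norm x"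
    by (simp add: power2_eq_iff_nonneg)
qed

lemma cmod_cinner_le: "cmod (cinner x y) \<le> norm x * norm y"
proof (cases "cinner x y = 0")
  case False
  define u where "u = cnj (cinner x y) / complex_of_real (cmod (cinner x y))"
  have u: "cmod u = 1"
    using False by (simp add: u_def norm_divide)
  have "u * cinner x y = complex_of_real (cmod (cinner x y))"
    using False complex_norm_square[of "cinner x y"]
    by (simp add: u_def field_simps power2_eq_square)
  then have "inner (u *\<^sub>C x) y = cmod (cinner x y)"
    by (simp add: inner_eq_Re_cinner cinner_scaleC_left)
  then show ?thesis
    using norm_cauchy_schwarz[of "u *\<^sub>C x" y] u by (simp add: norm_scaleC)
qed simp

definition infinite_dimensional :: "'h::complex_vector itself \<Rightarrow> bool" where
  "infinite_dimensional _ \<longleftrightarrow> (\<nexists>B :: 'h set. finite B \<and> complex_vector.span B = UNIV)"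


section \<open>Operators\<close>

text \<open>The type \<open>'a \<Rightarrow>\<^sub>L 'b\<close> consists of the real-linear bounded operators, with the operator norm.
  The bounded operators of the complex theory are the complex-linear elements.\<close>

instantiation blinfun :: (real_normed_vector, complex_normed_vector) complex_normed_vector
begin

lift_definition scaleC_blinfun :: "complex \<Rightarrow> 'a \<Rightarrow>\<^sub>L 'b \<Rightarrow> 'a \<Rightarrow>\<^sub>L 'b" is "\<lambda>c f v. c *\<^sub>C f v"
proof -
  fix c :: complex and f :: "'a \<Rightarrow> 'b"
  assume "bounded_linear f"
  moreover have "bounded_linear (\<lambda>x :: 'b. c *\<^sub>C x)"
    by (rule bounded_linear_intro[where K = "cmod c"])
      (simp_all add: scaleC_add_right scaleR_scaleC scaleC_scaleC norm_scaleC mult.commute)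
  ultimately show "bounded_linear (\<lambda>v. c *\<^sub>C f v)"
    by (rule bounded_linear_compose[rotated])
qed

instance
proof
  fix c :: complex and f :: "'a \<Rightarrow>\<^sub>L 'b"
  have le: "norm (d *\<^sub>C g) \<le> cmod d * norm g" for d and g :: "'a \<Rightarrow>\<^sub>L 'b"
  proof (rule norm_blinfun_bound)
    fix v
    have "norm (blinfun_apply (d *\<^sub>C g) v) = cmod d * norm (blinfun_apply g v)"
      by (simp add: scaleC_blinfun.rep_eq norm_scaleC)
    also have "\<dots> \<le> cmod d * (norm g * norm v)"
      by (intro mult_left_mono norm_blinfun) simp
    finally show "norm (blinfun_apply (d *\<^sub>C g) v) \<le> cmod d * norm g * norm v"
      by (simp add: mult.assoc)
  qed simp
  show "norm (c *\<^sub>C f) = cmod c * norm f"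
  proof (cases "c = 0")
    case True
    then show ?thesis using le[of 0 f] by simp
  next
    case False
    have "inverse c *\<^sub>C c *\<^sub>C f = f"
      using False by (intro blinfun_eqI) (simp add: scaleC_blinfun.rep_eq scaleC_scaleC scaleC_one)
    then have "norm f \<le> inverse (cmod c) * norm (c *\<^sub>C f)"
      using le[of "inverse c" "c *\<^sub>C f"] by (simp add: norm_inverse)
    then have "cmod c * norm f \<le> norm (c *\<^sub>C f)"
      using False by (simp add: field_simps)
    with le[of c f] show ?thesis by simp
  qed
qed (transfer; simp add: fun_eq_iff scaleC_add_left scaleC_add_right scaleC_scaleC scaleC_one
      scaleR_scaleC)+

end

definition bounded_operators :: "('a::complex_normed_vector \<Rightarrow>\<^sub>L 'b::complex_normed_vector) set"
  where "bounded_operators = {a :: 'a \<Rightarrow>\<^sub>L 'b. \<forall>c v. a (c *\<^sub>C v) = c *\<^sub>C a v}"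

text \<open>Existence of the adjoint is the Riesz representation theorem, whence the sort
  \<open>chilbert_space\<close>.\<close>

definition adj :: "('a::chilbert_space \<Rightarrow>\<^sub>L 'b::chilbert_space) \<Rightarrow> ('b \<Rightarrow>\<^sub>L 'a)" where
  "adj a = (THE b :: 'b \<Rightarrow>\<^sub>L 'a. \<forall>v w. cinner (a v) w = cinner v (b w))"

definition compact_operator :: "('a::real_normed_vector \<Rightarrow>\<^sub>L 'b::real_normed_vector) \<Rightarrow> bool" where
  "compact_operator a \<longleftrightarrow> compact (closure (blinfun_apply a ` cball 0 1))"

text \<open>\<open>A\<close> and \<open>B\<close> are meant to be \<open>*\<close>-subalgebras; the values of \<open>\<Phi>\<close> outside \<open>A\<close> are irrelevant.\<close>

definition star_isomorphism ::
  "('a::chilbert_space \<Rightarrow>\<^sub>L 'a) set \<Rightarrow> ('b::chilbert_space \<Rightarrow>\<^sub>L 'b) set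
    \<Rightarrow> (('a \<Rightarrow>\<^sub>L 'a) \<Rightarrow> ('b \<Rightarrow>\<^sub>L 'b)) \<Rightarrow> bool" where
  "star_isomorphism A B \<Phi> \<longleftrightarrow>
    bij_betw \<Phi> A B \<and>
    (\<forall>a\<in>A. \<forall>b\<in>A. \<Phi> (a + b) = \<Phi> a + \<Phi> b) \<and>
    (\<forall>c. \<forall>a\<in>A. \<Phi> (c *\<^sub>C a) = c *\<^sub>C \<Phi> a) \<and>
    (\<forall>a\<in>A. \<forall>b\<in>A. \<Phi> (a o\<^sub>L b) = \<Phi> a o\<^sub>L \<Phi> b) \<and>
    (\<forall>a\<in>A. \<Phi> (adj a) = adj (\<Phi> a))"


section \<open>Square-summable functions\<close>

typedef (overloaded) ('x, 'h::complex_inner) ell2 =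
  "{f :: 'x \<Rightarrow> 'h. (\<lambda>x. (norm (f x))\<^sup>2) summable_on UNIV}"
  morphisms ell2_apply Abs_ell2
  by (rule exI[of _ "\<lambda>_. 0"]) simp

setup_lifting type_definition_ell2

lemma norm_add_sq_le: "(norm (x + y))\<^sup>2 \<le> 2 * (norm x)\<^sup>2 + 2 * (norm (y :: 'a :: real_normed_vector))\<^sup>2"
proof -
  have "(norm (x + y))\<^sup>2 \<le> (norm x + norm y)\<^sup>2"
    by (intro power_mono norm_triangle_ineq) simp
  also have "\<dots> \<le> 2 * (norm x)\<^sup>2 + 2 * (norm y)\<^sup>2"
    using sum_squares_bound[of "norm x" "norm y"] by (simp add: power2_sum)
  finally show ?thesis .
qed

lemma ell2_add_summable:
  fixes f g :: "'x \<Rightarrow> 'h :: complex_inner"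
  assumes "(\<lambda>x. (norm (f x))\<^sup>2) summable_on UNIV" "(\<lambda>x. (norm (g x))\<^sup>2) summable_on UNIV"
  shows "(\<lambda>x. (norm (f x + g x))\<^sup>2) summable_on UNIV"
proof (rule summable_on_comparison_test)
  show "(\<lambda>x. 2 * (norm (f x))\<^sup>2 + 2 * (norm (g x))\<^sup>2) summable_on UNIV"
    by (intro summable_on_add summable_on_cmult_right assms)
qed (auto intro: norm_add_sq_le)

lemma ell2_scaleC_summable:
  fixes f :: "'x \<Rightarrow> 'h :: complex_inner"
  assumes "(\<lambda>x. (norm (f x))\<^sup>2) summable_on UNIV"
  shows "(\<lambda>x. (norm (c *\<^sub>C f x))\<^sup>2) summable_on UNIV"
  using summable_on_cmult_right[OF assms, of "(cmod c)\<^sup>2"]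
  by (simp add: norm_scaleC power_mult_distrib)

lemma ell2_cinner_summable:
  fixes f g :: "'x \<Rightarrow> 'h :: complex_inner"
  assumes "(\<lambda>x. (norm (f x))\<^sup>2) summable_on UNIV" "(\<lambda>x. (norm (g x))\<^sup>2) summable_on UNIV"
  shows "(\<lambda>x. cinner (f x) (g x)) summable_on UNIV"
proof (rule abs_summable_summable, rule summable_on_comparison_test)
  show "(\<lambda>x. (norm (f x))\<^sup>2 + (norm (g x))\<^sup>2) summable_on UNIV"
    by (intro summable_on_add assms)
  fix x
  have "cmod (cinner (f x) (g x)) \<le> norm (f x) * norm (g x)"
    by (rule cmod_cinner_le)
  also have "\<dots> \<le> (norm (f x))\<^sup>2 + (norm (g x))\<^sup>2"
    using sum_squares_bound[of "norm (f x)" "norm (g x)"]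
      mult_nonneg_nonneg[OF norm_ge_zero[of "f x"] norm_ge_zero[of "g x"]]
    unfolding mult.assoc by linarith
  finally show "cmod (cinner (f x) (g x)) \<le> (norm (f x))\<^sup>2 + (norm (g x))\<^sup>2" .
qed auto

instantiation ell2 :: (type, complex_inner) complex_inner
begin

lift_definition zero_ell2 :: "('a, 'b) ell2" is "\<lambda>_. 0" by simp

lift_definition plus_ell2 :: "('a, 'b) ell2 \<Rightarrow> ('a, 'b) ell2 \<Rightarrow> ('a, 'b) ell2" is
  "\<lambda>f g x. f x + g x"
  by (rule ell2_add_summable)

lift_definition uminus_ell2 :: "('a, 'b) ell2 \<Rightarrow> ('a, 'b) ell2" is "\<lambda>f x. - f x" by simp

lift_definition minus_ell2 :: "('a, 'b) ell2 \<Rightarrow> ('a, 'b) ell2 \<Rightarrow> ('a, 'b) ell2" is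
  "\<lambda>f g x. f x - g x"
  using ell2_add_summable[of _ "\<lambda>x. - g x" for g :: "'a \<Rightarrow> 'b"] by fastforce

lift_definition scaleC_ell2 :: "complex \<Rightarrow> ('a, 'b) ell2 \<Rightarrow> ('a, 'b) ell2" is
  "\<lambda>c f x. c *\<^sub>C f x"
  by (rule ell2_scaleC_summable)

definition scaleR_ell2 :: "real \<Rightarrow> ('a, 'b) ell2 \<Rightarrow> ('a, 'b) ell2" where
  "scaleR_ell2 r f = complex_of_real r *\<^sub>C f"

lift_definition cinner_ell2 :: "('a, 'b) ell2 \<Rightarrow> ('a, 'b) ell2 \<Rightarrow> complex" is
  "\<lambda>f g. \<Sum>\<^sub>\<infinity>x. cinner (f x) (g x)" .

definition inner_ell2 :: "('a, 'b) ell2 \<Rightarrow> ('a, 'b) ell2 \<Rightarrow> real" where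
  "inner_ell2 f g = Re (cinner f g)"

lift_definition norm_ell2 :: "('a, 'b) ell2 \<Rightarrow> real" is
  "\<lambda>f. sqrt (\<Sum>\<^sub>\<infinity>x. (norm (f x))\<^sup>2)" .

definition dist_ell2 :: "('a, 'b) ell2 \<Rightarrow> ('a, 'b) ell2 \<Rightarrow> real" where
  "dist_ell2 f g = norm (f - g)"

definition sgn_ell2 :: "('a, 'b) ell2 \<Rightarrow> ('a, 'b) ell2" where
  "sgn_ell2 f = inverse (norm f) *\<^sub>R f"

definition uniformity_ell2 :: "(('a, 'b) ell2 \<times> ('a, 'b) ell2) filter" where
  "uniformity_ell2 = (INF e\<in>{0 <..}. principal {(f, g). dist f g < e})"

definition open_ell2 :: "('a, 'b) ell2 set \<Rightarrow> bool" where
  "open_ell2 U \<longleftrightarrow> (\<forall>f\<in>U. \<forall>\<^sub>F (f', g) in uniformity. f' = f \<longrightarrow> g \<in> U)"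

instance
proof
  have add: "f + g + h = f + (g + h)" "f + g = g + f" "0 + f = f" "- f + f = 0" "f - g = f + - g"
    for f g h :: "('a, 'b) ell2"
    by (transfer; simp add: fun_eq_iff add.assoc add.commute)+
  have scale: "c *\<^sub>C (f + g) = c *\<^sub>C f + c *\<^sub>C g" "(c + d) *\<^sub>C f = c *\<^sub>C f + d *\<^sub>C f"
    "c *\<^sub>C (d *\<^sub>C f) = (c * d) *\<^sub>C f" "1 *\<^sub>C f = f"
    for c d and f g :: "('a, 'b) ell2"
    by (transfer; simp add: fun_eq_iff scaleC_add_right scaleC_add_left scaleC_scaleC scaleC_one)+
  have comm: "cinner f g = cnj (cinner g f)" for f g :: "('a, 'b) ell2"
    by transfer (subst infsum_cnj[symmetric], rule infsum_cong, rule cinner_commute)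
  have addl: "cinner (f + g) h = cinner f h + cinner g h" for f g h :: "('a, 'b) ell2"
    by transfer (simp add: cinner_add_left infsum_add ell2_cinner_summable)
  have scalel: "cinner (c *\<^sub>C f) g = c * cinner f g" for c and f g :: "('a, 'b) ell2"
    by transfer (simp add: cinner_scaleC_left infsum_cmult_right')
  have self: "cinner f f = complex_of_real ((norm f)\<^sup>2)" for f :: "('a, 'b) ell2"
  proof transfer
    fix f :: "'a \<Rightarrow> 'b"
    assume f: "(\<lambda>x. (norm (f x))\<^sup>2) summable_on UNIV"
    have "(sqrt (\<Sum>\<^sub>\<infinity>x. (norm (f x))\<^sup>2))\<^sup>2 = (\<Sum>\<^sub>\<infinity>x. (norm (f x))\<^sup>2)"
      by (intro real_sqrt_pow2 infsum_nonneg) simp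
    then show "(\<Sum>\<^sub>\<infinity>x. cinner (f x) (f x)) =
        complex_of_real ((sqrt (\<Sum>\<^sub>\<infinity>x. (norm (f x))\<^sup>2))\<^sup>2)"
      using infsumI[OF has_sum_of_real[OF has_sum_infsum[OF f]]]
      by (simp only: cinner_self)
  qed
  have nonneg: "0 \<le> norm f" for f :: "('a, 'b) ell2"
    by transfer (intro real_sqrt_ge_zero infsum_nonneg, simp)
  have zero: "norm f = 0 \<longleftrightarrow> f = 0" for f :: "('a, 'b) ell2"
  proof transfer
    fix f :: "'a \<Rightarrow> 'b"
    assume f: "(\<lambda>x. (norm (f x))\<^sup>2) summable_on UNIV"
    show "sqrt (\<Sum>\<^sub>\<infinity>x. (norm (f x))\<^sup>2) = 0 \<longleftrightarrow> f = (\<lambda>_. 0)"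
    proof
      assume "sqrt (\<Sum>\<^sub>\<infinity>x. (norm (f x))\<^sup>2) = 0"
      then have "(\<Sum>\<^sub>\<infinity>x. (norm (f x))\<^sup>2) = 0" by simp
      then have "(norm (f x))\<^sup>2 = 0" for x
        using finite_sum_le_infsum[OF f, of "{x}"] by simp
      then show "f = (\<lambda>_. 0)" by (simp add: fun_eq_iff)
    qed simp
  qed
  fix f g h :: "('a, 'b) ell2" and c d :: complex and r s :: real
  show "f + g + h = f + (g + h)" "f + g = g + f" "0 + f = f" "- f + f = 0" "f - g = f + - g"
    by (fact add)+
  show "c *\<^sub>C (f + g) = c *\<^sub>C f + c *\<^sub>C g" "(c + d) *\<^sub>C f = c *\<^sub>C f + d *\<^sub>C f"
    "c *\<^sub>C (d *\<^sub>C f) = (c * d) *\<^sub>C f" "1 *\<^sub>C f = f"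
    by (fact scale)+
  show "r *\<^sub>R (f + g) = r *\<^sub>R f + r *\<^sub>R g" "(r + s) *\<^sub>R f = r *\<^sub>R f + s *\<^sub>R f"
    "r *\<^sub>R s *\<^sub>R f = (r * s) *\<^sub>R f" "1 *\<^sub>R f = f"
    by (simp_all only: scaleR_ell2_def scale of_real_add of_real_mult of_real_1)
  show "r *\<^sub>R f = complex_of_real r *\<^sub>C f" by (fact scaleR_ell2_def)
  show "dist f g = norm (f - g)" by (fact dist_ell2_def)
  show "sgn f = inverse (norm f) *\<^sub>R f" by (fact sgn_ell2_def)
  show "uniformity = (INF e\<in>{0 <..}. principal {(f :: ('a, 'b) ell2, g). dist f g < e})"
    by (fact uniformity_ell2_def)
  show "open U \<longleftrightarrow> (\<forall>f\<in>U. \<forall>\<^sub>F (f', g) in uniformity. f' = f \<longrightarrow> g \<in> U)"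
    for U :: "('a, 'b) ell2 set"
    by (fact open_ell2_def)
  show "cinner f g = cnj (cinner g f)" by (fact comm)
  show "cinner (f + g) h = cinner f h + cinner g h" by (fact addl)
  show "cinner (c *\<^sub>C f) g = c * cinner f g" by (fact scalel)
  show "inner f g = Re (cinner f g)" by (fact inner_ell2_def)
  show "inner f g = inner g f"
    unfolding inner_ell2_def by (subst comm) simp
  show "inner (f + g) h = inner f h + inner g h"
    by (simp only: inner_ell2_def addl) simp
  show "inner (r *\<^sub>R f) g = r * inner f g"
    by (simp add: inner_ell2_def scaleR_ell2_def scalel)
  show "0 \<le> inner f f"
    by (simp add: inner_ell2_def self)
  show "inner f f = 0 \<longleftrightarrow> f = 0"
    by (simp add: inner_ell2_def self zero)
  show "norm f = sqrt (inner f f)"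
    by (simp add: inner_ell2_def self nonneg)
qed

end

lemma norm_ell2_apply_le: "norm (ell2_apply f x) \<le> norm f"
proof (rule power2_le_imp_le)
  have f: "(\<lambda>x. (norm (ell2_apply f x))\<^sup>2) summable_on UNIV"
    using ell2_apply[of f] by simp
  have "(norm (ell2_apply f x))\<^sup>2 \<le> (\<Sum>\<^sub>\<infinity>x. (norm (ell2_apply f x))\<^sup>2)"
    using finite_sum_le_infsum[OF f, of "{x}"] by simp
  also have "\<dots> = (norm f)\<^sup>2"
    by (simp add: norm_ell2.rep_eq infsum_nonneg)
  finally show "(norm (ell2_apply f x))\<^sup>2 \<le> (norm f)\<^sup>2" .
qed simp

lemma sum_norm_ell2_apply_le:
  assumes "finite F"
  shows "(\<Sum>x\<in>F. (norm (ell2_apply f x))\<^sup>2) \<le> (norm f)\<^sup>2"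
proof -
  have f: "(\<lambda>x. (norm (ell2_apply f x))\<^sup>2) summable_on UNIV"
    using ell2_apply[of f] by simp
  show ?thesis
    using finite_sum_le_infsum[OF f assms] by (simp add: norm_ell2.rep_eq infsum_nonneg)
qed

instance ell2 :: (type, chilbert_space) chilbert_space
proof
  fix f :: "nat \<Rightarrow> ('a, 'b) ell2"
  assume f: "Cauchy f"
  have "Cauchy (\<lambda>n. ell2_apply (f n) x)" for x
  proof (rule CauchyI)
    fix e :: real
    assume "e > 0"
    then obtain M where "norm (f m - f n) < e" if "m \<ge> M" "n \<ge> M" for m n
      using CauchyD[OF f] by blast
    then show "\<exists>M. \<forall>m\<ge>M. \<forall>n\<ge>M. norm (ell2_apply (f m) x - ell2_apply (f n) x) < e"
      by (metis minus_ell2.rep_eq norm_ell2_apply_le order_le_less_trans)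
  qed
  then have "\<exists>l. (\<lambda>n. ell2_apply (f n) x) \<longlonglongrightarrow> l" for x
    by (simp add: Cauchy_convergent_iff convergent_def)
  then obtain g where g: "(\<lambda>n. ell2_apply (f n) x) \<longlonglongrightarrow> g x" for x
    by metis
  have tail: "\<exists>M. \<forall>n\<ge>M. \<forall>F. finite F \<longrightarrow> (\<Sum>x\<in>F. (norm (ell2_apply (f n) x - g x))\<^sup>2) \<le> e\<^sup>2"
    if e: "e > 0" for e :: real
  proof -
    obtain M where M: "norm (f n - f m) < e" if "m \<ge> M" "n \<ge> M" for m n
      using CauchyD[OF f e] by blast
    have "(\<Sum>x\<in>F. (norm (ell2_apply (f n) x - g x))\<^sup>2) \<le> e\<^sup>2" if n: "n \<ge> M" and F: "finite F" for n F
    proof (rule LIMSEQ_le_const2)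
      show "(\<lambda>m. \<Sum>x\<in>F. (norm (ell2_apply (f n) x - ell2_apply (f m) x))\<^sup>2)
          \<longlonglongrightarrow> (\<Sum>x\<in>F. (norm (ell2_apply (f n) x - g x))\<^sup>2)"
        by (intro tendsto_intros g)
      have "(\<Sum>x\<in>F. (norm (ell2_apply (f n) x - ell2_apply (f m) x))\<^sup>2) \<le> e\<^sup>2" if "m \<ge> M" for m
      proof -
        have "(\<Sum>x\<in>F. (norm (ell2_apply (f n - f m) x))\<^sup>2) \<le> (norm (f n - f m))\<^sup>2"
          by (rule sum_norm_ell2_apply_le[OF F])
        also have "\<dots> \<le> e\<^sup>2"
          using M[OF that n] by (intro power_mono) auto
        finally show ?thesis by (simp add: minus_ell2.rep_eq)
      qed
      then show "\<exists>N. \<forall>m\<ge>N. (\<Sum>x\<in>F. (norm (ell2_apply (f n) x - ell2_apply (f m) x))\<^sup>2) \<le> e\<^sup>2"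
        by blast
    qed
    then show ?thesis by blast
  qed
  have summ: "(\<lambda>x. (norm (ell2_apply (f n) x - g x))\<^sup>2) summable_on UNIV"
    and le: "(\<Sum>\<^sub>\<infinity>x. (norm (ell2_apply (f n) x - g x))\<^sup>2) \<le> e\<^sup>2"
    if "\<And>F. finite F \<Longrightarrow> (\<Sum>x\<in>F. (norm (ell2_apply (f n) x - g x))\<^sup>2) \<le> e\<^sup>2" for n and e :: real
  proof -
    show *: "(\<lambda>x. (norm (ell2_apply (f n) x - g x))\<^sup>2) summable_on UNIV"
      by (rule nonneg_bdd_above_summable_on) (auto intro!: bdd_aboveI2[where M = "e\<^sup>2"] that)
    show "(\<Sum>\<^sub>\<infinity>x. (norm (ell2_apply (f n) x - g x))\<^sup>2) \<le> e\<^sup>2"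
      by (rule infsum_le_finite_sums[OF *]) (simp add: that)
  qed
  obtain n where n: "(\<lambda>x. (norm (ell2_apply (f n) x - g x))\<^sup>2) summable_on UNIV"
  proof -
    obtain M where M: "\<And>n F. n \<ge> M \<Longrightarrow> finite F \<Longrightarrow>
        (\<Sum>x\<in>F. (norm (ell2_apply (f n) x - g x))\<^sup>2) \<le> 1\<^sup>2"
      using tail[OF zero_less_one] by blast
    show ?thesis
      by (rule that[OF summ[OF M]]) auto
  qed
  have "(\<lambda>x. (norm (ell2_apply (f n) x + (- 1) *\<^sub>C (ell2_apply (f n) x - g x)))\<^sup>2) summable_on UNIV"
    using ell2_apply[of "f n"] n by (intro ell2_add_summable ell2_scaleC_summable) auto
  moreover have "(- 1) *\<^sub>C z = - z" for z :: 'b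
    using complex_vector.scale_minus_left[of 1 z] by (simp add: scaleC_one)
  ultimately have "(\<lambda>x. (norm (g x))\<^sup>2) summable_on UNIV"
    by simp
  then obtain G where G: "ell2_apply G = g"
    using Abs_ell2_inverse by blast
  have "f \<longlonglongrightarrow> G"
  proof (rule LIMSEQ_I)
    fix e :: real
    assume e: "e > 0"
    obtain M where M: "\<And>n F. n \<ge> M \<Longrightarrow> finite F \<Longrightarrow>
        (\<Sum>x\<in>F. (norm (ell2_apply (f n) x - g x))\<^sup>2) \<le> (e/2)\<^sup>2"
      using tail[of "e/2"] e by auto
    have "norm (f n - G) < e" if "n \<ge> M" for n
    proof -
      have "norm (f n - G) = sqrt (\<Sum>\<^sub>\<infinity>x. (norm (ell2_apply (f n) x - g x))\<^sup>2)"
        by (simp add: norm_ell2.rep_eq minus_ell2.rep_eq G)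
      also have "\<dots> \<le> sqrt ((e/2)\<^sup>2)"
        using le[of n "e/2"] M[OF that] by (intro real_sqrt_le_mono) blast
      also have "\<dots> < e" using e by simp
      finally show ?thesis .
    qed
    then show "\<exists>M. \<forall>n\<ge>M. norm (f n - G) < e" by blast
  qed
  then show "convergent f" by (auto simp: convergent_def)
qed

lift_definition delta :: "'x \<Rightarrow> 'h \<Rightarrow> ('x, 'h::complex_inner) ell2" is
  "\<lambda>x \<eta> z. if z = x then \<eta> else 0"
proof -
  fix x :: 'x and \<eta> :: 'h
  have "(\<lambda>z. (norm (if z = x then \<eta> else 0))\<^sup>2) summable_on UNIV \<longleftrightarrow>
      (\<lambda>z. (norm (if z = x then \<eta> else 0))\<^sup>2) summable_on {x}"
    by (rule summable_on_cong_neutral) auto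
  then show "(\<lambda>z. (norm (if z = x then \<eta> else 0))\<^sup>2) summable_on UNIV"
    by simp
qed

lemma norm_delta [simp]: "norm (delta x \<eta>) = norm \<eta>"
proof -
  have "(\<Sum>\<^sub>\<infinity>z. (norm (if z = x then \<eta> else 0))\<^sup>2)
      = (\<Sum>\<^sub>\<infinity>z\<in>{x}. (norm (if z = x then \<eta> else 0))\<^sup>2)"
    by (rule infsum_cong_neutral) auto
  then show ?thesis
    by (simp add: norm_ell2.rep_eq delta.rep_eq)
qed

lemma cinner_delta_right: "cinner f (delta y \<eta>) = cinner (ell2_apply f y) \<eta>"
proof -
  have "(\<Sum>\<^sub>\<infinity>z. cinner (ell2_apply f z) (if z = y then \<eta> else 0))
      = (\<Sum>\<^sub>\<infinity>z\<in>{y}. cinner (ell2_apply f z) (if z = y then \<eta> else 0))"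
    by (rule infsum_cong_neutral) auto
  then show ?thesis
    by (simp add: cinner_ell2.rep_eq delta.rep_eq)
qed

lemma bounded_linear_delta: "bounded_linear (delta x :: 'h \<Rightarrow> ('x, 'h::complex_inner) ell2)"
proof (rule bounded_linear_intro[where K = 1])
  show "delta x (\<xi> + \<eta>) = delta x \<xi> + delta x \<eta>" for \<xi> \<eta> :: 'h
    by transfer (auto simp: fun_eq_iff)
  show "delta x (r *\<^sub>R \<xi>) = r *\<^sub>R delta x \<xi>" for r and \<xi> :: 'h
    unfolding scaleR_scaleC by transfer (auto simp: fun_eq_iff)
qed simp

lemma bounded_linear_ell2_apply:
  "bounded_linear (\<lambda>f. ell2_apply f y :: 'h::complex_inner)"
  by (rule bounded_linear_intro[where K = 1])
    (simp_all add: plus_ell2.rep_eq scaleR_scaleC scaleC_ell2.rep_eq norm_ell2_apply_le)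


section \<open>Roe algebras\<close>

definition entry :: "(('x, 'h::chilbert_space) ell2 \<Rightarrow>\<^sub>L ('x, 'h) ell2) \<Rightarrow> 'x \<Rightarrow> 'x \<Rightarrow> 'h \<Rightarrow>\<^sub>L 'h" where
  "entry a x y = (THE b :: 'h \<Rightarrow>\<^sub>L 'h. \<forall>\<xi> \<eta>. cinner (b \<xi>) \<eta> = cinner (a (delta x \<xi>)) (delta y \<eta>))"

lemma
  fixes a :: "('x, 'h::chilbert_space) ell2 \<Rightarrow>\<^sub>L ('x, 'h) ell2"
  shows entry_apply: "entry a x y \<xi> = ell2_apply (a (delta x \<xi>)) y"
  and cinner_entry: "cinner (entry a x y \<xi>) \<eta> = cinner (a (delta x \<xi>)) (delta y \<eta>)"
proof -
  define b where "b = Blinfun (\<lambda>\<xi>. ell2_apply (a (delta x \<xi>)) y)"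
  have "bounded_linear (\<lambda>\<xi>. ell2_apply (a (delta x \<xi>)) y)"
    by (rule bounded_linear_compose[OF bounded_linear_ell2_apply
          bounded_linear_blinfun_apply[OF bounded_linear_delta]])
  then have b: "blinfun_apply b \<xi> = ell2_apply (a (delta x \<xi>)) y" for \<xi>
    by (simp add: b_def bounded_linear_Blinfun_apply)
  have "entry a x y = b"
    unfolding entry_def
  proof (rule the_equality)
    show "\<forall>\<xi> \<eta>. cinner (b \<xi>) \<eta> = cinner (a (delta x \<xi>)) (delta y \<eta>)"
      by (simp add: b cinner_delta_right)
    show "b' = b" if "\<forall>\<xi> \<eta>. cinner (b' \<xi>) \<eta> = cinner (a (delta x \<xi>)) (delta y \<eta>)"
      for b' :: "'h \<Rightarrow>\<^sub>L 'h"
      using that by (intro blinfun_eqI cinner_ext) (simp add: b cinner_delta_right)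
  qed
  then show "entry a x y \<xi> = ell2_apply (a (delta x \<xi>)) y"
    and "cinner (entry a x y \<xi>) \<eta> = cinner (a (delta x \<xi>)) (delta y \<eta>)"
    by (simp_all add: b cinner_delta_right)
qed

text \<open>Values in \<open>ennreal\<close> give the supremum of the empty set the value 0, so \<open>propagation 0 = 0\<close>.\<close>

definition propagation ::
  "(('x::metric_space, 'h::chilbert_space) ell2 \<Rightarrow>\<^sub>L ('x, 'h) ell2) \<Rightarrow> ennreal" where
  "propagation a = Sup {ennreal (dist x y) |x y. entry a x y \<noteq> 0}"

definition band_dominated ::
  "(('x::metric_space, 'h::chilbert_space) ell2 \<Rightarrow>\<^sub>L ('x, 'h) ell2) set" where
  "band_dominated = closure {a \<in> bounded_operators. propagation a < \<infinity>}"

definition roe_algebra ::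
  "(('x::metric_space, 'h::chilbert_space) ell2 \<Rightarrow>\<^sub>L ('x, 'h) ell2) set" where
  "roe_algebra = {a \<in> band_dominated. \<forall>x y. compact_operator (entry a x y)}"

definition uniformly_locally_finite :: "'x::metric_space itself \<Rightarrow> bool" where
  "uniformly_locally_finite _ \<longleftrightarrow>
    (\<forall>r>0. \<exists>N. \<forall>x::'x. finite (cball x r) \<and> card (cball x r) \<le> N)"

definition coarse_like ::
  "((('x::metric_space, 'h::chilbert_space) ell2 \<Rightarrow>\<^sub>L ('x, 'h) ell2) \<Rightarrow>
    (('y::metric_space, 'h) ell2 \<Rightarrow>\<^sub>L ('y, 'h) ell2)) \<Rightarrow> bool" where
  "coarse_like \<Phi> \<longleftrightarrow>
    (\<forall>\<epsilon>>0. \<forall>r>0. \<exists>s>0. \<forall>a\<in>roe_algebra. norm a \<le> 1 \<and> propagation a \<le> ennreal r \<longrightarrow>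
      (\<exists>c\<in>roe_algebra. propagation c \<le> ennreal s \<and> norm (\<Phi> a - c) \<le> \<epsilon>))"

end

theory Submission
  imports Defs
begin

text \<open>An isomorphism \<open>\<Phi>\<close> of Roe algebras is implemented by a unitary \<open>U\<close> (\<open>star_isomorphism_unitary\<close>), hence
  continuous for weak operator limits of bounded families. This makes a Baire category argument
  possible. Give the contractions of propagation at most \<open>r\<close> with compact entries the topology in which two
  operators are close if they agree on a large finite block of their matrices. Limits of coherent blocks
  exist, so the category argument applies. The operators whose image is within \<open>\<epsilon>\<close> of
  propagation \<open>n\<close> form a closed set, because bounded families have weak cluster points and
  propagation does not increase in weak limits. These sets exhaust the contractions, so one of them has an
  interior point: for some \<open>n\<close>, some finite \<open>F \<subseteq> X\<close> and some \<open>a0\<close>, every contraction that agrees with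
  \<open>a0\<close> on \<open>F \<times> F\<close> has an image close to propagation \<open>n\<close> (\<open>approximable_interior\<close>).

  Now let \<open>a\<close> be any of these contractions. Its block on the complement of \<open>F\<close> can be glued to the block of
  \<open>a0\<close> on \<open>F\<close>, and the block of \<open>a0\<close> alone is also admissible. Hence the image of the block of \<open>a\<close> off \<open>F\<close> is
  a difference of two approximable operators. The rest of \<open>a\<close> lives on a finite set \<open>G\<close> that depends only on
  \<open>F\<close> and \<open>r\<close>. The operators on \<open>G\<close> are not a compact family, since \<open>H\<close> is infinite-dimensional, so
  approximating them one by one does not suffice. What controls them uniformly is tightness of the unitary:
  up to a small error in norm, \<open>U\<close> maps all of \<open>\<ell>\<^sub>2(G, H)\<close> into \<open>\<ell>\<^sub>2(F', H)\<close> for some finite \<open>F' \<subseteq> Y\<close>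
  (\<open>tight\<close>). Tightness holds because columns of elements of the Roe algebra are compact, and
  because the Roe algebra of \<open>Y\<close> contains every diagonal operator whose entries are projections onto lines.

  The approximants obtained so far need not have compact entries. A last step replaces them by elements of
  the Roe algebra whose propagation is no larger (\<open>approximant_in_roe_algebra\<close>).\<close>


section \<open>Operators defined by sesquilinear forms\<close>

lemma cinner_scaleR_left: "cinner (r *\<^sub>R x) y = complex_of_real r * cinner x y"
  by (simp add: scaleR_scaleC cinner_scaleC_left)

text \<open>The vector representing a functional minimises \<open>\<lambda>v. \<parallel>v\<parallel>\<^sup>2 - 2 f v\<close>; the parallelogram law makes
  every minimising sequence Cauchy.\<close>

lemma riesz_representation:
  fixes f :: "'a::{real_inner,complete_space} \<Rightarrow> real"
  assumes "bounded_linear f"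
  shows "\<exists>u. \<forall>v. f v = inner u v"
proof -
  interpret f: bounded_linear f by fact
  obtain K where K: "\<And>v. norm (f v) \<le> norm v * K"
    using f.bounded by blast
  define Q where "Q v = (norm v)\<^sup>2 - 2 * f v" for v
  have "- K\<^sup>2 \<le> Q v" for v
  proof -
    have "0 \<le> (norm v - K)\<^sup>2" by simp
    then show ?thesis
      using K[of v] by (simp add: Q_def power2_diff abs_le_iff)
  qed
  then have bdd: "bdd_below (range Q)" by (auto intro!: bdd_belowI2)
  define m where "m = Inf (range Q)"
  have m: "m \<le> Q v" for v
    unfolding m_def by (rule cINF_lower[OF bdd]) simp
  have "\<exists>v. Q v < m + inverse (real (Suc n))" for n
  proof -
    have "Inf (range Q) < m + inverse (real (Suc n))" by (simp add: m_def)
    then show ?thesis using cInf_lessD[of "range Q"] by blast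
  qed
  then obtain v where v: "\<And>n. Q (v n) < m + inverse (real (Suc n))" by metis
  have par: "(norm (x - y))\<^sup>2 = 2 * Q x + 2 * Q y - 4 * Q ((1/2) *\<^sub>R (x + y))" for x y
    by (simp add: Q_def f.scaleR f.add power2_norm_eq_inner inner_simps inner_commute field_simps)
  have "Cauchy v"
  proof (rule CauchyI)
    fix e :: real
    assume e: "e > 0"
    then obtain N where N: "inverse (real (Suc N)) < e\<^sup>2 / 4"
      using reals_Archimedean[of "e\<^sup>2 / 4"] by auto
    have "norm (v i - v j) < e" if "i \<ge> N" "j \<ge> N" for i j
    proof (rule power2_less_imp_less)
      have "inverse (real (Suc i)) \<le> inverse (real (Suc N))" "inverse (real (Suc j)) \<le> inverse (real (Suc N))"
        using that by (simp_all add: field_simps)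
      then show "(norm (v i - v j))\<^sup>2 < e\<^sup>2"
        using par[of "v i" "v j"] v[of i] v[of j] m[of "(1/2) *\<^sub>R (v i + v j)"] N by linarith
    qed (use e in simp)
    then show "\<exists>M. \<forall>i\<ge>M. \<forall>j\<ge>M. norm (v i - v j) < e" by blast
  qed
  then obtain u where u: "v \<longlonglongrightarrow> u"
    using Cauchy_convergent convergent_def by blast
  have "(\<lambda>n. Q (v n)) \<longlonglongrightarrow> Q u"
    unfolding Q_def by (intro tendsto_intros u f.tendsto)
  moreover have "(\<lambda>n. m + inverse (real (Suc n))) \<longlonglongrightarrow> m + 0"
    by (intro tendsto_intros LIMSEQ_inverse_real_of_nat)
  ultimately have "Q u \<le> m + 0"
    using v by (intro LIMSEQ_le[where X = "\<lambda>n. Q (v n)"]) (auto intro: less_imp_le)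
  then have Qu: "Q u \<le> Q w" for w
    using m[of w] by simp
  have "f w = inner u w" for w
  proof (rule ccontr)
    assume ne: "f w \<noteq> inner u w"
    define d where "d = f w - inner u w"
    define n where "n = (norm w)\<^sup>2 + 1"
    have n: "n > 0" by (simp add: n_def add_nonneg_pos)
    have "Q (u + (d / n) *\<^sub>R w) = Q u - 2 * (d/n) * d + (d/n)\<^sup>2 * (norm w)\<^sup>2"
    proof -
      define t where "t = d / n"
      have "(norm (u + t *\<^sub>R w))\<^sup>2 = (norm u)\<^sup>2 + 2 * t * inner u w + t\<^sup>2 * (norm w)\<^sup>2"
        unfolding power2_norm_eq_inner
        by (simp add: inner_add_left inner_add_right inner_commute[of w u] power2_eq_square algebra_simps)
      then show ?thesis
        unfolding t_def[symmetric] by (simp add: Q_def f.scaleR f.add d_def algebra_simps)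
    qed
    moreover have "(d/n)\<^sup>2 * (norm w)\<^sup>2 \<le> (d/n)\<^sup>2 * n"
      by (intro mult_left_mono) (auto simp: n_def)
    moreover have "(d/n)\<^sup>2 * n = (d/n) * d"
      using n by (simp add: power2_eq_square)
    moreover have "(d/n) * d > 0"
    proof -
      have "0 < d\<^sup>2 / n" using n ne by (intro divide_pos_pos) (simp_all add: d_def)
      then show ?thesis by (simp add: power2_eq_square)
    qed
    ultimately show False using Qu[of "u + (d / n) *\<^sub>R w"] by linarith
  qed
  then show ?thesis by blast
qed

lemma norm_blinfun_apply_le: "norm a \<le> K \<Longrightarrow> norm (blinfun_apply a v) \<le> K * norm v"
  using norm_blinfun[of a v] mult_right_mono[of "norm a" K "norm v"] by simp

lemma bounded_operators_scaleC: "a \<in> bounded_operators \<Longrightarrow> blinfun_apply a (c *\<^sub>C v) = c *\<^sub>C a v"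
  by (simp add: bounded_operators_def)

text \<open>The representing vectors come from the real Riesz theorem applied to the real part of the form; complex
  linearity recovers the imaginary part from the real part at \<open>\<i> w\<close>.\<close>

lemma operator_of_sesquilinear_form:
  fixes B :: "'a::complex_inner \<Rightarrow> 'b::chilbert_space \<Rightarrow> complex"
  assumes add_left: "\<And>u v w. B (u + v) w = B u w + B v w"
    and scale_left: "\<And>c v w. B (c *\<^sub>C v) w = c * B v w"
    and add_right: "\<And>u v w. B u (v + w) = B u v + B u w"
    and scale_right: "\<And>c v w. B v (c *\<^sub>C w) = cnj c * B v w"
    and bound: "\<And>v w. cmod (B v w) \<le> K * norm v * norm w"
    and K: "0 \<le> K"
  shows "\<exists>b\<in>bounded_operators. (\<forall>v w. cinner (blinfun_apply b v) w = B v w) \<and> norm b \<le> K"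
proof -
  have "\<exists>u. \<forall>w. cinner u w = B v w" for v
  proof -
    have "bounded_linear (\<lambda>w. Re (B v w))"
    proof (rule bounded_linear_intro)
      show "norm (Re (B v w)) \<le> norm w * (K * norm v)" for w
        using order_trans[OF abs_Re_le_cmod bound[of v w]] by (simp add: mult_ac)
    qed (simp_all add: add_right scaleR_scaleC scale_right)
    then obtain u where u: "\<And>w. Re (B v w) = inner u w"
      using riesz_representation by blast
    have "cinner u w = B v w" for w
    proof (rule complex_eqI)
      show "Re (cinner u w) = Re (B v w)"
        by (simp add: u inner_eq_Re_cinner)
      have "Re (cinner u (\<i> *\<^sub>C w)) = Re (B v (\<i> *\<^sub>C w))"
        by (simp add: u inner_eq_Re_cinner)
      then show "Im (cinner u w) = Im (B v w)"
        by (simp add: cinner_scaleC_right scale_right)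
    qed
    then show ?thesis by blast
  qed
  then obtain g where g: "\<And>v w. cinner (g v) w = B v w" by metis
  have add: "g (u + v) = g u + g v" for u v
    by (rule cinner_ext) (simp add: g cinner_add_left add_left)
  have scale: "g (c *\<^sub>C v) = c *\<^sub>C g v" for c v
    by (rule cinner_ext) (simp add: g cinner_scaleC_left scale_left)
  have norm: "norm (g v) \<le> K * norm v" for v
  proof (cases "g v = 0")
    case False
    have "(norm (g v))\<^sup>2 = cmod (B v (g v))"
      by (simp add: g[symmetric] cinner_self norm_power)
    also have "\<dots> \<le> K * norm v * norm (g v)" by (rule bound)
    finally show ?thesis using False by (simp add: power2_eq_square)
  qed (use K in simp)
  have "bounded_linear g"
    by (rule bounded_linear_intro[where K = K]) (simp_all add: add scaleR_scaleC scale norm mult.commute)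
  then have b: "blinfun_apply (Blinfun g) = g"
    by (rule bounded_linear_Blinfun_apply)
  show ?thesis
    by (rule bexI[of _ "Blinfun g"])
      (auto simp: b g bounded_operators_def scale intro!: norm_blinfun_bound K norm)
qed

lemma adj_eqI:
  assumes "\<And>v w. cinner (blinfun_apply a v) w = cinner v (blinfun_apply b w)"
  shows "adj a = b"
  unfolding adj_def
proof (rule the_equality)
  fix b' :: "'b \<Rightarrow>\<^sub>L 'a"
  assume "\<forall>v w. cinner (blinfun_apply a v) w = cinner v (blinfun_apply b' w)"
  with assms have "cinner (b' w) v = cinner (b w) v" for v w
    by (metis cinner_commute)
  then show "b' = b" by (intro blinfun_eqI cinner_ext)
qed (simp add: assms)

lemma adjoint_exists:
  fixes a :: "'a::chilbert_space \<Rightarrow>\<^sub>L 'b::chilbert_space"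
  assumes "a \<in> bounded_operators"
  shows "\<exists>b\<in>bounded_operators. (\<forall>v w. cinner (blinfun_apply a v) w = cinner v (blinfun_apply b w))
    \<and> norm b \<le> norm a"
proof -
  have "\<exists>b\<in>bounded_operators. (\<forall>w v. cinner (blinfun_apply b w) v = cinner w (a v)) \<and> norm b \<le> norm a"
  proof (rule operator_of_sesquilinear_form)
    show "cmod (cinner w (a v)) \<le> norm a * norm w * norm v" for v w
    proof -
      have "cmod (cinner w (a v)) \<le> norm w * norm (a v)" by (rule cmod_cinner_le)
      also have "\<dots> \<le> norm w * (norm a * norm v)" by (intro mult_left_mono norm_blinfun) simp
      finally show ?thesis by (simp add: mult_ac)
    qed
  qed (simp_all add: cinner_add_left cinner_add_right cinner_scaleC_left cinner_scaleC_right
      blinfun.add_right bounded_operators_scaleC[OF assms])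
  then show ?thesis by (metis cinner_commute)
qed

lemma cinner_adj:
  assumes "a \<in> bounded_operators"
  shows "cinner (blinfun_apply a v) w = cinner v (blinfun_apply (adj a) w)"
  using adjoint_exists[OF assms] adj_eqI by blast

lemma bounded_operators_compose:
  "a \<in> bounded_operators \<Longrightarrow> b \<in> bounded_operators \<Longrightarrow> a o\<^sub>L b \<in> bounded_operators"
  by (simp add: bounded_operators_def)

lemma bounded_operators_add:
  "a \<in> bounded_operators \<Longrightarrow> b \<in> bounded_operators \<Longrightarrow> a + b \<in> bounded_operators"
  by (simp add: bounded_operators_def blinfun.add_left scaleC_add_right)

lemma bounded_operators_diff:
  "a \<in> bounded_operators \<Longrightarrow> b \<in> bounded_operators \<Longrightarrow> a - b \<in> bounded_operators"
  by (simp add: bounded_operators_def blinfun.diff_left complex_vector.scale_right_diff_distrib)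

lemma closed_bounded_operators:
  "closed (bounded_operators :: ('a::complex_normed_vector \<Rightarrow>\<^sub>L 'b::complex_normed_vector) set)"
proof -
  have "bounded_linear (\<lambda>x::'b. c *\<^sub>C x)" for c
    by (rule bounded_linear_intro[where K = "cmod c"])
      (simp_all add: scaleC_add_right scaleR_scaleC scaleC_scaleC norm_scaleC mult.commute)
  then have "bounded_linear (\<lambda>a :: 'a \<Rightarrow>\<^sub>L 'b. c *\<^sub>C blinfun_apply a v)" for c v
    by (rule bounded_linear_compose[OF _ blinfun.bounded_linear_left])
  then have "closed {a :: 'a \<Rightarrow>\<^sub>L 'b. blinfun_apply a (c *\<^sub>C v) = c *\<^sub>C a v}" for c v
    by (intro closed_Collect_eq linear_continuous_on blinfun.bounded_linear_left)
  then show ?thesis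
    unfolding bounded_operators_def by (intro closed_Collect_all)
qed

section \<open>Weak operator limits\<close>

text \<open>Along an ultrafilter, matrix coefficients of a bounded family converge and so define a weak
  operator limit. Tychonoff's theorem for the product of discs gives a cluster point of the
  coefficient functions, and the filter refined at this cluster point serves as the ultrafilter.\<close>

lemma weak_operator_cluster_point:
  fixes c :: "'i \<Rightarrow> ('a::chilbert_space \<Rightarrow>\<^sub>L 'b::chilbert_space)"
  assumes F: "F \<noteq> bot"
    and c: "\<forall>\<^sub>F i in F. c i \<in> bounded_operators \<and> norm (c i) \<le> K"
  shows "\<exists>G b. G \<le> F \<and> G \<noteq> bot \<and> b \<in> bounded_operators \<and> norm b \<le> K \<and>
    (\<forall>v w. ((\<lambda>i. cinner (blinfun_apply (c i) v) w) \<longlongrightarrow> cinner (blinfun_apply b v) w) G)"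
proof -
  obtain i where "norm (c i) \<le> K"
    using eventually_happens'[OF F c] by blast
  then have K: "0 \<le> K" using norm_ge_zero order_trans by blast
  define form where "form i = (\<lambda>(v, w). cinner (blinfun_apply (c i) v) w)" for i
  define S where "S = (\<Pi>\<^sub>E p\<in>UNIV. cball (0::complex) (K * norm (fst p :: 'a) * norm (snd p :: 'b)))"
  have "compactin (product_topology (\<lambda>_. euclidean) UNIV) S"
    unfolding S_def by (simp add: compactin_PiE)
  then have "compact S"
    by (simp add: euclidean_product_topology)
  moreover have "eventually (\<lambda>f. f \<in> S) (filtermap form F)"
    unfolding eventually_filtermap using c
  proof eventually_elim
    case (elim i)
    have "cmod (cinner (c i v) w) \<le> K * norm v * norm w" for v w
    proof -
      have "cmod (cinner (c i v) w) \<le> norm (c i v) * norm w" by (rule cmod_cinner_le)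
      also have "\<dots> \<le> (K * norm v) * norm w"
        using elim by (intro mult_right_mono norm_blinfun_apply_le) auto
      finally show ?thesis .
    qed
    then show ?case by (auto simp: S_def form_def)
  qed
  moreover have "filtermap form F \<noteq> bot"
    using F by (simp add: filtermap_bot_iff)
  ultimately obtain f where "f \<in> S" and f: "inf (nhds f) (filtermap form F) \<noteq> bot"
    unfolding compact_filter by blast
  define G where "G = inf (filtercomap form (nhds f)) F"
  have G: "G \<noteq> bot"
  proof
    assume "G = bot"
    then have "eventually (\<lambda>_. False) G" by simp
    then obtain P' Q where "eventually P' (filtercomap form (nhds f))" and Q: "eventually Q F"
      and PQ': "\<And>i. P' i \<and> Q i \<Longrightarrow> False"
      unfolding G_def eventually_inf by blast
    then obtain P where P: "eventually P (nhds f)" and PP: "\<And>i. P (form i) \<Longrightarrow> P' i"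
      unfolding eventually_filtercomap by blast
    have PQ: "P (form i) \<Longrightarrow> Q i \<Longrightarrow> False" for i
      using PP PQ' by blast
    have "eventually (\<lambda>g. \<not> P g) (filtermap form F)"
      unfolding eventually_filtermap using Q by eventually_elim (use PQ in blast)
    then have "eventually (\<lambda>_. False) (inf (nhds f) (filtermap form F))"
      unfolding eventually_inf using P by blast
    then show False using f by (simp add: eventually_False)
  qed
  have GF: "G \<le> F" by (simp add: G_def)
  have "filterlim form (nhds f) G"
    unfolding G_def filterlim_def
    by (rule order_trans[OF filtermap_mono[OF inf_le1] filtermap_filtercomap])
  then have "((\<lambda>i. form i p) \<longlongrightarrow> f p) G" for p
    by (rule continuous_on_tendsto_compose[OF continuous_on_product_coordinates]) simp_all
  from this[of "(v, w)" for v w]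
  have lim: "((\<lambda>i. cinner (c i v) w) \<longlongrightarrow> f (v, w)) G" for v w
    by (simp add: form_def)
  have lin: "\<forall>\<^sub>F i in G. c i \<in> bounded_operators"
    using filter_leD[OF GF c] by eventually_elim simp
  have eqI: "s = t" if "(g \<longlongrightarrow> s) G" "(h \<longlongrightarrow> t) G" "\<forall>\<^sub>F i in G. g i = h i"
    for s t :: complex and g h
  proof (rule tendsto_unique[OF G that(1)])
    show "(g \<longlongrightarrow> t) G" using that(2) tendsto_cong[OF that(3)] by blast
  qed
  have "\<exists>b\<in>bounded_operators. (\<forall>v w. cinner (blinfun_apply b v) w = f (v, w)) \<and> norm b \<le> K"
  proof (rule operator_of_sesquilinear_form)
    show "f (u + v, w) = f (u, w) + f (v, w)" for u v w
      by (rule eqI[OF lim tendsto_add[OF lim lim]])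
        (simp add: blinfun.add_right cinner_add_left)
    show "f (d *\<^sub>C v, w) = d * f (v, w)" for d v w
      by (rule eqI[OF lim tendsto_mult_left[OF lim]])
        (use lin in eventually_elim, simp add: bounded_operators_scaleC cinner_scaleC_left)
    show "f (u, v + w) = f (u, v) + f (u, w)" for u v w
      by (rule eqI[OF lim tendsto_add[OF lim lim]]) (simp add: cinner_add_right)
    show "f (v, d *\<^sub>C w) = cnj d * f (v, w)" for d v w
      by (rule eqI[OF lim tendsto_mult_left[OF lim]]) (simp add: cinner_scaleC_right)
    show "cmod (f (v, w)) \<le> K * norm v * norm w" for v w
      using \<open>f \<in> S\<close> by (auto simp: S_def PiE_def Pi_def)
  qed (rule K)
  then obtain b where "b \<in> bounded_operators" "norm b \<le> K"
    and "\<And>v w. cinner (blinfun_apply b v) w = f (v, w)" by blast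
  with lim G GF show ?thesis by (intro exI[of _ G] exI[of _ b]) simp
qed

lemma norm_le_if_weak_limit:
  fixes a :: "'a::chilbert_space \<Rightarrow>\<^sub>L 'b::chilbert_space"
  assumes G: "G \<noteq> bot" and K: "0 \<le> K"
    and lim: "\<And>v w. ((\<lambda>i. cinner (blinfun_apply (c i) v) w) \<longlongrightarrow> cinner (blinfun_apply a v) w) G"
    and c: "\<forall>\<^sub>F i in G. norm (c i) \<le> K"
  shows "norm a \<le> K"
proof (rule norm_blinfun_bound[OF K])
  fix v
  have "cmod (cinner (a v) (a v)) \<le> K * norm v * norm (a v)"
  proof (rule tendsto_upperbound[OF tendsto_norm[OF lim] _ G])
    show "\<forall>\<^sub>F i in G. cmod (cinner (c i v) (a v)) \<le> K * norm v * norm (a v)"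
      using c
    proof eventually_elim
      case (elim i)
      have "cmod (cinner (c i v) (a v)) \<le> norm (c i v) * norm (a v)" by (rule cmod_cinner_le)
      also have "\<dots> \<le> (K * norm v) * norm (a v)"
        using elim by (intro mult_right_mono norm_blinfun_apply_le) auto
      finally show ?case .
    qed
  qed
  then have "(norm (a v))\<^sup>2 \<le> K * norm v * norm (a v)"
    by (simp add: cinner_self norm_power)
  then show "norm (a v) \<le> K * norm v"
    using K by (cases "a v = 0") (auto simp: power2_eq_square)
qed


section \<open>Compact operators\<close>

lemma norm_blinfun_compose_le: "norm a \<le> K \<Longrightarrow> norm b \<le> L \<Longrightarrow> norm (a o\<^sub>L b) \<le> K * L"
  by (rule order_trans[OF norm_blinfun_compose mult_mono]) (auto intro: order_trans[OF norm_ge_zero])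

text \<open>Total boundedness at a single scale.\<close>

definition finite_net :: "real \<Rightarrow> 'a::metric_space set \<Rightarrow> bool" where
  "finite_net e S \<longleftrightarrow> (\<exists>k. finite k \<and> S \<subseteq> (\<Union>x\<in>k. ball x e))"

lemma finite_net_subset: "finite_net e T \<Longrightarrow> S \<subseteq> T \<Longrightarrow> finite_net e S"
  unfolding finite_net_def by blast

lemma finite_net_near:
  assumes "finite_net e T" "\<And>s. s \<in> S \<Longrightarrow> \<exists>t\<in>T. dist s t \<le> d"
  shows "finite_net (e + d) S"
proof -
  obtain k where k: "finite k" "T \<subseteq> (\<Union>x\<in>k. ball x e)"
    using assms(1) unfolding finite_net_def by blast
  have "S \<subseteq> (\<Union>x\<in>k. ball x (e + d))"
  proof
    fix s assume "s \<in> S"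
    then obtain t where "t \<in> T" and t: "dist s t \<le> d" using assms(2) by blast
    then obtain x where x: "x \<in> k" "dist x t < e" using k by auto
    then have "dist x s < e + d"
      using dist_triangle[of x s t] t by (simp add: dist_commute)
    with x show "s \<in> (\<Union>x\<in>k. ball x (e + d))" by auto
  qed
  with k show ?thesis unfolding finite_net_def by blast
qed

lemma compact_closure_iff_finite_net:
  fixes S :: "'a::{real_normed_vector,complete_space} set"
  shows "compact (closure S) \<longleftrightarrow> (\<forall>e>0. finite_net e S)"
proof
  assume "compact (closure S)"
  then have "\<forall>e>0. finite_net e (closure S)"
    unfolding compact_eq_totally_bounded finite_net_def by simp
  then show "\<forall>e>0. finite_net e S"
    using finite_net_subset[OF _ closure_subset] by blast
next
  assume *: "\<forall>e>0. finite_net e S"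
  have "finite_net e (closure S)" if "e > 0" for e
  proof -
    have "\<exists>t\<in>S. dist s t \<le> e/2" if "s \<in> closure S" for s
    proof -
      have "e/2 > 0" using \<open>e > 0\<close> by simp
      with that obtain t where "t \<in> S" "dist t s < e/2"
        unfolding closure_approachable by blast
      then show ?thesis by (intro bexI[of _ t]) (simp_all add: dist_commute)
    qed
    then show ?thesis using finite_net_near[of "e/2" S "closure S" "e/2"] * \<open>e > 0\<close> by simp
  qed
  then show "compact (closure S)"
    unfolding compact_eq_totally_bounded finite_net_def by (simp add: complete_eq_closed)
qed

lemma compact_operator_iff:
  fixes a :: "'a::real_normed_vector \<Rightarrow>\<^sub>L 'b::{real_normed_vector,complete_space}"
  shows "compact_operator a \<longleftrightarrow> (\<forall>e>0. finite_net e (blinfun_apply a ` cball 0 1))"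
  by (simp add: compact_operator_def compact_closure_iff_finite_net)

lemma compact_operator_limit:
  fixes a :: "'a::real_normed_vector \<Rightarrow>\<^sub>L 'b::{real_normed_vector,complete_space}"
  assumes "\<And>e. e > 0 \<Longrightarrow> \<exists>b. compact_operator b \<and> norm (a - b) \<le> e"
  shows "compact_operator a"
  unfolding compact_operator_iff
proof (intro allI impI)
  fix e :: real
  assume "e > 0"
  then obtain b where b: "compact_operator b" "norm (a - b) \<le> e/2"
    using assms[of "e/2"] by auto
  have "\<exists>t\<in>blinfun_apply b ` cball 0 1. dist s t \<le> e/2" if "s \<in> blinfun_apply a ` cball 0 1" for s
  proof -
    from that obtain v where v: "s = a v" "norm v \<le> 1" by auto
    have "norm ((a - b) v) \<le> e/2 * norm v" by (rule norm_blinfun_apply_le[OF b(2)])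
    also have "\<dots> \<le> e/2" using v \<open>e > 0\<close> by simp
    finally have "dist (a v) (b v) \<le> e/2" by (simp add: dist_norm blinfun.diff_left)
    with v show ?thesis by auto
  qed
  with finite_net_near[of "e/2" "blinfun_apply b ` cball 0 1" "blinfun_apply a ` cball 0 1" "e/2"]
  show "finite_net e (blinfun_apply a ` cball 0 1)"
    using b(1) \<open>e > 0\<close> by (simp add: compact_operator_iff)
qed

lemma compact_operator_if_image_subset:
  fixes a :: "'a::real_normed_vector \<Rightarrow>\<^sub>L 'b::real_normed_vector"
  assumes "compact T" "blinfun_apply a ` cball 0 1 \<subseteq> T"
  shows "compact_operator a"
  unfolding compact_operator_def
  by (metis assms compact_Int_closed closed_closure closure_minimal compact_imp_closed inf.absorb2)

lemma compact_operator_zero [simp]: "compact_operator 0"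
  by (rule compact_operator_if_image_subset[of "{0}"]) auto

lemma compact_operator_add:
  fixes a b :: "'a::real_normed_vector \<Rightarrow>\<^sub>L 'b::real_normed_vector"
  assumes "compact_operator a" "compact_operator b"
  shows "compact_operator (a + b)"
proof (rule compact_operator_if_image_subset)
  let ?A = "closure (blinfun_apply a ` cball 0 1)" and ?B = "closure (blinfun_apply b ` cball 0 1)"
  show "compact {x + y |x y. x \<in> ?A \<and> y \<in> ?B}"
    using assms by (intro compact_sums) (simp_all add: compact_operator_def)
  show "blinfun_apply (a + b) ` cball 0 1 \<subseteq> {x + y |x y. x \<in> ?A \<and> y \<in> ?B}"
    using closure_subset[of "blinfun_apply a ` cball 0 1"] closure_subset[of "blinfun_apply b ` cball 0 1"]
    by (fastforce simp: blinfun.add_left)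
qed

lemma compact_operator_sum:
  "(\<And>i. i \<in> I \<Longrightarrow> compact_operator (f i)) \<Longrightarrow> compact_operator (\<Sum>i\<in>I. f i)"
  by (induction I rule: infinite_finite_induct) (simp_all add: compact_operator_add)

lemma compact_operator_compose_left:
  fixes a :: "'a::real_normed_vector \<Rightarrow>\<^sub>L 'b::real_normed_vector"
    and b :: "'b \<Rightarrow>\<^sub>L 'c::real_normed_vector"
  assumes "compact_operator a"
  shows "compact_operator (b o\<^sub>L a)"
proof (rule compact_operator_if_image_subset)
  show "compact (blinfun_apply b ` closure (blinfun_apply a ` cball 0 1))"
    using assms unfolding compact_operator_def
    by (intro compact_continuous_image linear_continuous_on blinfun.bounded_linear_right)
  show "blinfun_apply (b o\<^sub>L a) ` cball 0 1 \<subseteq> blinfun_apply b ` closure (blinfun_apply a ` cball 0 1)"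
    using closure_subset by fastforce
qed

lemma compact_operator_compose_right:
  fixes a :: "'b::real_normed_vector \<Rightarrow>\<^sub>L 'c::real_normed_vector"
    and b :: "'a::real_normed_vector \<Rightarrow>\<^sub>L 'b"
  assumes "compact_operator a"
  shows "compact_operator (a o\<^sub>L b)"
proof (rule compact_operator_if_image_subset)
  let ?K = "norm b + 1"
  have K: "?K > 0" by (simp add: add_nonneg_pos)
  show "compact ((\<lambda>v. ?K *\<^sub>R v) ` closure (blinfun_apply a ` cball 0 1))"
    using assms unfolding compact_operator_def by (rule compact_scaling)
  show "blinfun_apply (a o\<^sub>L b) ` cball 0 1
      \<subseteq> (\<lambda>v. ?K *\<^sub>R v) ` closure (blinfun_apply a ` cball 0 1)"
  proof (clarsimp simp del: image_eqI)
    fix v :: 'a assume v: "norm v \<le> 1"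
    have "norm (b v) \<le> norm b * norm v" by (rule norm_blinfun)
    also have "\<dots> \<le> norm b * 1" using v by (intro mult_left_mono) auto
    finally have "norm ((1/?K) *\<^sub>R b v) \<le> 1" using K by (simp add: field_simps)
    then have "a ((1/?K) *\<^sub>R b v) \<in> closure (blinfun_apply a ` cball 0 1)"
      using closure_subset[of "blinfun_apply a ` cball 0 1"] by fastforce
    moreover have "?K *\<^sub>R a ((1/?K) *\<^sub>R b v) = a (b v)"
      using K by (simp add: blinfun.scaleR_right)
    ultimately show "a (b v) \<in> (\<lambda>v. ?K *\<^sub>R v) ` closure (blinfun_apply a ` cball 0 1)"
      by (metis image_eqI)
  qed
qed

definition rank_one :: "'b::complex_inner \<Rightarrow> 'a::complex_inner \<Rightarrow> 'a \<Rightarrow>\<^sub>L 'b" where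
  "rank_one v w = Blinfun (\<lambda>u. cinner u w *\<^sub>C v)"

lemma rank_one_apply: "blinfun_apply (rank_one v w) u = cinner u w *\<^sub>C v"
proof -
  have "bounded_linear (\<lambda>u. cinner u w *\<^sub>C v)"
  proof (rule bounded_linear_intro)
    show "norm (cinner u w *\<^sub>C v) \<le> norm u * (norm w * norm v)" for u
      using mult_right_mono[OF cmod_cinner_le[of u w] norm_ge_zero[of v]] by (simp add: norm_scaleC mult_ac)
  qed (simp_all add: cinner_add_left scaleC_add_left cinner_scaleR_left scaleR_scaleC scaleC_scaleC cinner_scaleC_left)
  then show ?thesis by (simp add: rank_one_def bounded_linear_Blinfun_apply)
qed

lemma rank_one_bounded_operators: "rank_one v w \<in> bounded_operators"
  by (simp add: bounded_operators_def rank_one_apply cinner_scaleC_left scaleC_scaleC)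

lemma compact_rank_one: "compact_operator (rank_one v w)"
proof (rule compact_operator_if_image_subset)
  have "bounded_linear (\<lambda>c. c *\<^sub>C v)"
    by (rule bounded_linear_intro[where K = "norm v"])
      (simp_all add: scaleC_add_left scaleR_scaleC scaleC_scaleC norm_scaleC scaleR_conv_of_real)
  then show "compact ((\<lambda>c. c *\<^sub>C v) ` cball (0::complex) (norm w))"
    by (intro compact_continuous_image linear_continuous_on compact_cball)
  show "blinfun_apply (rank_one v w) ` cball 0 1 \<subseteq> (\<lambda>c. c *\<^sub>C v) ` cball (0::complex) (norm w)"
  proof
    fix t assume "t \<in> blinfun_apply (rank_one v w) ` cball 0 1"
    then obtain u where "t = rank_one v w u" and "norm u \<le> 1" by auto
    then have u: "t = cinner u w *\<^sub>C v" "norm u \<le> 1" by (simp_all add: rank_one_apply)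
    have "cmod (cinner u w) \<le> norm u * norm w" by (rule cmod_cinner_le)
    also have "\<dots> \<le> 1 * norm w" using u by (intro mult_right_mono) auto
    finally show "t \<in> (\<lambda>c. c *\<^sub>C v) ` cball (0::complex) (norm w)" using u by auto
  qed
qed

lemma adj_rank_one: "adj (rank_one v w) = rank_one w v"
proof (rule adj_eqI)
  show "cinner (rank_one v w x) y = cinner x (rank_one w v y)" for x y
    using cinner_commute[of y v]
    by (simp add: rank_one_apply cinner_scaleC_left cinner_scaleC_right mult.commute)
qed


section \<open>Diagonal operators and cutoffs\<close>

lemma ell2_eqI: "(\<And>x. ell2_apply f x = ell2_apply g x) \<Longrightarrow> f = g"
  by (simp add: ell2_apply_inject[symmetric] fun_eq_iff)

lemma ell2_summable: "(\<lambda>x. (norm (ell2_apply f x))\<^sup>2) summable_on UNIV"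
  using ell2_apply[of f] by simp

lemma norm_ell2_sq: "(norm f)\<^sup>2 = (\<Sum>\<^sub>\<infinity>x. (norm (ell2_apply f x))\<^sup>2)"
  by (simp add: norm_ell2.rep_eq infsum_nonneg)

lemma ell2_apply_scaleR: "ell2_apply (r *\<^sub>R f) x = r *\<^sub>R ell2_apply f x"
  by (simp add: scaleR_scaleC scaleC_ell2.rep_eq)

lemma ell2_apply_sum: "ell2_apply (\<Sum>i\<in>I. f i) x = (\<Sum>i\<in>I. ell2_apply (f i) x)"
  by (induction I rule: infinite_finite_induct) (simp_all add: zero_ell2.rep_eq plus_ell2.rep_eq)

lemma norm_ell2_mono:
  fixes f :: "('x, 'h::complex_inner) ell2" and g :: "('x, 'g::complex_inner) ell2"
  assumes "\<And>x. norm (ell2_apply f x) \<le> K * norm (ell2_apply g x)" "0 \<le> K"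
  shows "norm f \<le> K * norm g"
proof (rule power2_le_imp_le)
  have "(norm f)\<^sup>2 \<le> (\<Sum>\<^sub>\<infinity>x. K\<^sup>2 * (norm (ell2_apply g x))\<^sup>2)"
    unfolding norm_ell2_sq
    by (intro infsum_mono ell2_summable summable_on_cmult_right)
      (simp add: assms power_mono flip: power_mult_distrib)
  then show "(norm f)\<^sup>2 \<le> (K * norm g)\<^sup>2"
    by (simp add: infsum_cmult_right' norm_ell2_sq[symmetric] power_mult_distrib)
qed (simp add: assms)

text \<open>Meaningful only if the norms of the \<open>p x\<close> are bounded; otherwise the underlying function need not map
  \<open>\<ell>\<^sub>2\<close> to \<open>\<ell>\<^sub>2\<close>.\<close>

definition diagonal :: "('x \<Rightarrow> 'h::chilbert_space \<Rightarrow>\<^sub>L 'h) \<Rightarrow> ('x, 'h) ell2 \<Rightarrow>\<^sub>L ('x, 'h) ell2" where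
  "diagonal p = Blinfun (\<lambda>f. Abs_ell2 (\<lambda>x. p x (ell2_apply f x)))"

lemma
  assumes p: "\<And>x. norm (p x) \<le> K"
  shows diagonal_apply: "ell2_apply (diagonal p f) x = p x (ell2_apply f x)"
    and norm_diagonal: "norm (diagonal p) \<le> K"
proof -
  have K: "0 \<le> K" using p norm_ge_zero order_trans by blast
  have "(\<lambda>x. (norm (p x (ell2_apply f x)))\<^sup>2) summable_on UNIV" for f
  proof (rule summable_on_comparison_test)
    show "(\<lambda>x. K\<^sup>2 * (norm (ell2_apply f x))\<^sup>2) summable_on UNIV"
      by (intro summable_on_cmult_right ell2_summable)
    show "(norm (p x (ell2_apply f x)))\<^sup>2 \<le> K\<^sup>2 * (norm (ell2_apply f x))\<^sup>2" for x
      unfolding power_mult_distrib[symmetric]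
      by (intro power_mono norm_blinfun_apply_le[OF p]) simp
  qed simp
  moreover define D where "D f = Abs_ell2 (\<lambda>x. p x (ell2_apply f x))" for f
  ultimately have ap: "ell2_apply (D f) x = p x (ell2_apply f x)" for f x
    by (simp add: Abs_ell2_inverse)
  have norm: "norm (D f) \<le> K * norm f" for f
    by (rule norm_ell2_mono) (simp_all add: ap norm_blinfun_apply_le[OF p] K)
  have "bounded_linear D"
  proof (rule bounded_linear_intro[where K = K])
    show "norm (D f) \<le> norm f * K" for f
      using norm[of f] by (simp add: mult.commute)
  qed (rule ell2_eqI, simp add: ap plus_ell2.rep_eq blinfun.add_right ell2_apply_scaleR blinfun.scaleR_right)+
  then have d: "blinfun_apply (diagonal p) f = D f" for f
    by (simp add: diagonal_def bounded_linear_Blinfun_apply flip: D_def)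
  show "ell2_apply (diagonal p f) x = p x (ell2_apply f x)" by (simp add: d ap)
  show "norm (diagonal p) \<le> K" by (rule norm_blinfun_bound[OF K]) (simp add: d norm)
qed

lemma diagonal_bounded_operators:
  assumes "\<And>x. norm (p x) \<le> K" "\<And>x. p x \<in> bounded_operators"
  shows "diagonal p \<in> bounded_operators"
  unfolding bounded_operators_def
  by (auto intro!: ell2_eqI simp: diagonal_apply[OF assms(1)] scaleC_ell2.rep_eq bounded_operators_scaleC[OF assms(2)])

definition cutoff :: "'x set \<Rightarrow> ('x, 'h::chilbert_space) ell2 \<Rightarrow>\<^sub>L ('x, 'h) ell2" where
  "cutoff A = diagonal (\<lambda>x. if x \<in> A then id_blinfun else 0)"

lemma cutoff_apply: "ell2_apply (cutoff A f) x = (if x \<in> A then ell2_apply f x else 0)"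
  unfolding cutoff_def
  by (subst diagonal_apply[where K = 1]) (simp_all add: norm_blinfun_id_le)

lemma norm_cutoff: "norm (cutoff A) \<le> 1"
  unfolding cutoff_def by (rule norm_diagonal) (simp add: norm_blinfun_id_le)

lemma norm_cutoff_apply: "norm (cutoff A f) \<le> norm f"
  using norm_blinfun_apply_le[OF norm_cutoff] by force

lemma cutoff_bounded_operators: "cutoff A \<in> bounded_operators"
  by (auto intro!: ell2_eqI simp: bounded_operators_def cutoff_apply scaleC_ell2.rep_eq)

lemma cutoff_decompose: "cutoff A f + cutoff (- A) f = f"
  by (rule ell2_eqI) (simp add: plus_ell2.rep_eq cutoff_apply)

lemma cutoff_Compl: "cutoff (- A) f = f - cutoff A f"
  by (rule ell2_eqI) (simp add: minus_ell2.rep_eq cutoff_apply)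

lemma cutoff_cutoff: "cutoff A (cutoff B f) = cutoff (A \<inter> B) f"
  by (rule ell2_eqI) (simp add: cutoff_apply)

lemma cinner_cutoff: "cinner (cutoff A f) g = cinner f (cutoff A g)"
  unfolding cinner_ell2.rep_eq by (rule infsum_cong) (simp add: cutoff_apply)

lemma norm_cutoff_sum_sq: "(norm f)\<^sup>2 = (norm (cutoff A f))\<^sup>2 + (norm (cutoff (- A) f))\<^sup>2"
proof -
  have "cutoff A (cutoff (- A) f) = 0"
    by (rule ell2_eqI) (simp add: cutoff_apply zero_ell2.rep_eq)
  then have 0: "cinner (cutoff A f) (cutoff (- A) f) = 0"
    by (simp add: cinner_cutoff)
  have "complex_of_real ((norm f)\<^sup>2) = cinner (cutoff A f + cutoff (- A) f) (cutoff A f + cutoff (- A) f)"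
    by (simp only: cutoff_decompose cinner_self)
  also have "\<dots> = cinner (cutoff A f) (cutoff A f) + cinner (cutoff (- A) f) (cutoff (- A) f)"
    using 0 cinner_commute[of "cutoff (- A) f" "cutoff A f"]
    by (simp only: cinner_add_left cinner_add_right) simp
  also have "\<dots> = complex_of_real ((norm (cutoff A f))\<^sup>2 + (norm (cutoff (- A) f))\<^sup>2)"
    by (simp only: cinner_self of_real_add)
  finally show ?thesis by (simp only: of_real_eq_iff)
qed

lemma cutoff_finite:
  assumes "finite F"
  shows "cutoff F f = (\<Sum>x\<in>F. delta x (ell2_apply f x))"
  by (rule ell2_eqI) (use assms in \<open>simp add: cutoff_apply ell2_apply_sum delta.rep_eq sum.delta\<close>)

lemma tendsto_cutoff_Compl:
  "((\<lambda>F. norm (cutoff (- F) f)) \<longlongrightarrow> 0) (finite_subsets_at_top UNIV)"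
proof -
  have fin: "(norm (cutoff F f))\<^sup>2 = (\<Sum>x\<in>F. (norm (ell2_apply f x))\<^sup>2)" if "finite F" for F
  proof -
    have "(norm (cutoff F f))\<^sup>2 = (\<Sum>\<^sub>\<infinity>x\<in>F. (norm (ell2_apply f x))\<^sup>2)"
      unfolding norm_ell2_sq by (rule infsum_cong_neutral) (auto simp: cutoff_apply)
    then show ?thesis using that by simp
  qed
  have "(sum (\<lambda>x. (norm (ell2_apply f x))\<^sup>2) \<longlongrightarrow> (norm f)\<^sup>2) (finite_subsets_at_top UNIV)"
    using has_sum_infsum[OF ell2_summable[of f]] by (simp add: has_sum_def norm_ell2_sq)
  then have "((\<lambda>F. sqrt ((norm f)\<^sup>2 - (\<Sum>x\<in>F. (norm (ell2_apply f x))\<^sup>2))) \<longlongrightarrow> sqrt ((norm f)\<^sup>2 - (norm f)\<^sup>2))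
      (finite_subsets_at_top UNIV)"
    by (intro tendsto_intros)
  moreover have "\<forall>\<^sub>F F in finite_subsets_at_top UNIV.
      norm (cutoff (- F) f) = sqrt ((norm f)\<^sup>2 - (\<Sum>x\<in>F. (norm (ell2_apply f x))\<^sup>2))"
    using norm_cutoff_sum_sq[of f] fin
    by (intro eventually_finite_subsets_at_top_weakI) (metis add_diff_cancel_left' norm_ge_zero real_sqrt_abs abs_of_nonneg)
  ultimately show ?thesis
    by (subst tendsto_cong) auto
qed

lemma exists_finite_cutoff:
  assumes "e > 0"
  obtains F where "finite F" "\<And>F'. finite F' \<Longrightarrow> F \<subseteq> F' \<Longrightarrow> norm (cutoff (- F') f) < e"
proof -
  have "\<forall>\<^sub>F F in finite_subsets_at_top UNIV. norm (cutoff (- F) f) < e"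
    using tendsto_cutoff_Compl[of f] assms by (rule order_tendstoD)
  then show thesis using that unfolding eventually_finite_subsets_at_top by auto
qed


section \<open>Matrix entries, propagation and the Roe algebra\<close>

definition delta_op :: "'x \<Rightarrow> 'h::complex_inner \<Rightarrow>\<^sub>L ('x, 'h) ell2" where
  "delta_op x = Blinfun (delta x)"

lemma delta_op_apply: "blinfun_apply (delta_op x) \<xi> = delta x \<xi>"
  by (simp add: delta_op_def bounded_linear_Blinfun_apply bounded_linear_delta)

lemma delta_scaleC: "delta x (c *\<^sub>C \<xi>) = c *\<^sub>C delta x \<xi>"
  by (rule ell2_eqI) (simp add: delta.rep_eq scaleC_ell2.rep_eq)

lemma delta_op_bounded_operators: "delta_op x \<in> bounded_operators"
  by (simp add: bounded_operators_def delta_op_apply delta_scaleC)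

lemma norm_delta_op: "norm (delta_op x) \<le> 1"
  by (rule norm_blinfun_bound) (simp_all add: delta_op_apply)

lemma entry_add: "entry (a + b) x y = entry a x y + entry b x y"
  by (rule blinfun_eqI) (simp add: entry_apply blinfun.add_left plus_ell2.rep_eq)

lemma entry_diff: "entry (a - b) x y = entry a x y - entry b x y"
  by (rule blinfun_eqI) (simp add: entry_apply blinfun.diff_left minus_ell2.rep_eq)

lemma entry_compose_diagonal:
  assumes "\<And>x. norm (p x) \<le> K"
  shows "entry (a o\<^sub>L diagonal p) x y = entry a x y o\<^sub>L p x"
proof (rule blinfun_eqI)
  have "diagonal p (delta x \<xi>) = delta x (p x \<xi>)" for \<xi>
    by (rule ell2_eqI) (simp add: diagonal_apply[OF assms] delta.rep_eq)
  then show "entry (a o\<^sub>L diagonal p) x y \<xi> = (entry a x y o\<^sub>L p x) \<xi>" for \<xi>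
    by (simp add: entry_apply)
qed

lemma entry_diagonal:
  assumes "\<And>x. norm (p x) \<le> K"
  shows "entry (diagonal p) x y = (if x = y then p x else 0)"
  by (rule blinfun_eqI) (simp add: entry_apply diagonal_apply[OF assms] delta.rep_eq)

lemma cutoff_delta: "cutoff A (delta x \<xi>) = (if x \<in> A then delta x \<xi> else 0)"
  by (rule ell2_eqI) (simp add: cutoff_apply delta.rep_eq zero_ell2.rep_eq)

definition compress :: "'x set \<Rightarrow> (('x, 'h::chilbert_space) ell2 \<Rightarrow>\<^sub>L ('x, 'h) ell2)
    \<Rightarrow> ('x, 'h) ell2 \<Rightarrow>\<^sub>L ('x, 'h) ell2" where
  "compress A a = cutoff A o\<^sub>L a o\<^sub>L cutoff A"

lemma compress_apply: "blinfun_apply (compress A a) v = cutoff A (a (cutoff A v))"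
  by (simp add: compress_def)

lemma entry_compress: "entry (compress A a) x y = (if x \<in> A \<and> y \<in> A then entry a x y else 0)"
  by (rule blinfun_eqI) (simp add: entry_apply compress_apply cutoff_delta cutoff_apply zero_ell2.rep_eq)

lemma compress_bounded_operators: "a \<in> bounded_operators \<Longrightarrow> compress A a \<in> bounded_operators"
  by (simp add: compress_def bounded_operators_compose cutoff_bounded_operators)

lemma norm_compress: "norm (compress A a) \<le> norm a"
  using norm_blinfun_compose_le[OF norm_blinfun_compose_le[OF norm_cutoff order_refl] norm_cutoff]
  unfolding compress_def by fastforce

text \<open>A vector supported in a finite set is a finite sum of vectors \<open>\<delta>\<^sub>x \<otimes> \<xi>\<close>, whose images the entries describe.\<close>

lemma compress_eqI:
  fixes a b :: "('a, 'b::chilbert_space) ell2 \<Rightarrow>\<^sub>L ('a, 'b) ell2"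
  assumes "finite F" and "\<And>x y. x \<in> F \<Longrightarrow> y \<in> F \<Longrightarrow> entry a x y = entry b x y"
  shows "compress F a = compress F b"
proof (rule blinfun_eqI, rule ell2_eqI)
  fix v y
  have "ell2_apply (c (cutoff F v)) y = (\<Sum>x\<in>F. entry c x y (ell2_apply v x))"
    for c :: "('a, 'b) ell2 \<Rightarrow>\<^sub>L ('a, 'b) ell2"
    by (simp add: cutoff_finite[OF assms(1)] blinfun.sum_right ell2_apply_sum entry_apply)
  then show "ell2_apply (compress F a v) y = ell2_apply (compress F b v) y"
    by (simp add: compress_apply cutoff_apply assms)
qed

lemma propagation_le_iff:
  assumes "0 \<le> s"
  shows "propagation a \<le> ennreal s \<longleftrightarrow> (\<forall>x y. s < dist x y \<longrightarrow> entry a x y = 0)"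
proof -
  have "propagation a \<le> ennreal s \<longleftrightarrow> (\<forall>x y. entry a x y \<noteq> 0 \<longrightarrow> ennreal (dist x y) \<le> ennreal s)"
    unfolding propagation_def Sup_le_iff by blast
  then show ?thesis
    using assms by (simp add: ennreal_le_iff) (meson not_le)
qed

lemma finite_propagation_bound:
  assumes "propagation a < \<infinity>"
  obtains s where "0 \<le> s" "propagation a \<le> ennreal s"
proof (cases "propagation a")
  case (real s)
  then show thesis by (intro that[of s]) simp_all
qed (use assms in simp)

text \<open>The bound is the diameter of the finite set, the same for all operators.\<close>

lemma propagation_compress_finite:
  assumes "finite F"
  obtains s where "0 \<le> s" "\<And>a. propagation (compress F a) \<le> ennreal s"
proof -
  have fin: "finite (insert 0 ((\<lambda>(x, y). dist x y) ` (F \<times> F)))" using assms by simp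
  define s where "s = Max (insert 0 ((\<lambda>(x, y). dist x y) ` (F \<times> F)))"
  have "0 \<le> s" unfolding s_def by (rule Max_ge[OF fin]) simp
  moreover have "dist x y \<le> s" if "x \<in> F" "y \<in> F" for x y
    unfolding s_def using that by (intro Max_ge[OF fin]) auto
  then have "propagation (compress F a) \<le> ennreal s" for a
    unfolding propagation_le_iff[OF \<open>0 \<le> s\<close>] by (auto simp: entry_compress not_le[symmetric])
  ultimately show thesis using that by blast
qed

lemma roe_algebraI:
  assumes "a \<in> bounded_operators" "propagation a \<le> ennreal s" "\<And>x y. compact_operator (entry a x y)"
  shows "a \<in> roe_algebra"
proof -
  have "propagation a < \<infinity>" using assms(2) by (simp add: order_le_less_trans)
  then have "a \<in> band_dominated"
    unfolding band_dominated_def by (intro subsetD[OF closure_subset]) (simp add: assms(1))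
  then show ?thesis using assms(3) by (simp add: roe_algebra_def)
qed

lemma roe_algebra_approx:
  assumes "a \<in> roe_algebra" "e > 0"
  obtains c s where "c \<in> bounded_operators" "0 \<le> s" "propagation c \<le> ennreal s" "norm (a - c) < e"
proof -
  have "a \<in> closure {a \<in> bounded_operators. propagation a < \<infinity>}"
    using assms(1) by (simp add: roe_algebra_def band_dominated_def)
  then obtain c where c: "c \<in> bounded_operators" "propagation c < \<infinity>" "dist c a < e"
    using assms(2) unfolding closure_approachable by blast
  obtain s where s: "0 \<le> s" "propagation c \<le> ennreal s"
    by (rule finite_propagation_bound[OF c(2)])
  have "norm (a - c) < e"
    using c(3) by (simp add: dist_norm norm_minus_commute)
  with c(1) s show thesis by (rule that)
qed

lemma roe_algebra_bounded_operators: "a \<in> roe_algebra \<Longrightarrow> a \<in> bounded_operators"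
proof -
  have "band_dominated \<subseteq> bounded_operators"
    unfolding band_dominated_def by (rule closure_minimal) (auto simp: closed_bounded_operators)
  then show "a \<in> roe_algebra \<Longrightarrow> a \<in> bounded_operators" by (auto simp: roe_algebra_def)
qed

lemma norm_rank_one_le: "norm (rank_one v w) \<le> norm v * norm w"
proof (rule norm_blinfun_bound)
  show "norm (rank_one v w u) \<le> norm v * norm w * norm u" for u
    using mult_right_mono[OF cmod_cinner_le[of u w] norm_ge_zero[of v]]
    by (simp add: rank_one_apply norm_scaleC mult_ac)
qed simp

text \<open>Cutting both vectors off to a large finite set changes a rank one operator little in norm and gives it
  finite propagation.\<close>

lemma rank_one_in_roe_algebra: "rank_one v w \<in> roe_algebra"
proof -
  have entry: "entry (rank_one v w) x y = rank_one (ell2_apply v y) (ell2_apply w x)" for v w x y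
  proof (rule blinfun_eqI)
    fix \<xi>
    have "cinner (delta x \<xi>) w = cinner \<xi> (ell2_apply w x)"
      using cinner_delta_right[of w x \<xi>] by (metis cinner_commute)
    then show "entry (rank_one v w) x y \<xi> = rank_one (ell2_apply v y) (ell2_apply w x) \<xi>"
      by (simp add: entry_apply rank_one_apply scaleC_ell2.rep_eq)
  qed
  have "\<exists>c\<in>{a \<in> bounded_operators. propagation a < \<infinity>}. dist c (rank_one v w) < e" if "e > 0" for e
  proof -
    \<comment> \<open>With tails of norm below \<open>d\<close> the error is at most \<open>norm v * d + d * norm w < e\<close>.\<close>
    define d where "d = e / (norm v + norm w + 1)"
    have pos: "norm v + norm w + 1 > 0" by (simp add: add_nonneg_pos)
    then have d: "d > 0" using that by (simp add: d_def)
    obtain A B where "finite A" and A: "\<And>F. finite F \<Longrightarrow> A \<subseteq> F \<Longrightarrow> norm (cutoff (- F) v) < d"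
      and "finite B" and B: "\<And>F. finite F \<Longrightarrow> B \<subseteq> F \<Longrightarrow> norm (cutoff (- F) w) < d"
      using exists_finite_cutoff[OF d] by metis
    define F where "F = A \<union> B"
    have F: "finite F" "norm (cutoff (- F) v) < d" "norm (cutoff (- F) w) < d"
      using \<open>finite A\<close> \<open>finite B\<close> A[of F] B[of F] by (auto simp: F_def)
    let ?c = "rank_one (cutoff F v) (cutoff F w)"
    have "?c = compress F (rank_one v w)"
      by (rule blinfun_eqI)
        (simp add: compress_apply rank_one_apply cinner_cutoff
          bounded_operators_scaleC[OF cutoff_bounded_operators])
    then have "propagation ?c < \<infinity>"
      using propagation_compress_finite[OF F(1)]
      by (metis ennreal_less_top infinity_ennreal_def order_le_less_trans)
    moreover have "dist ?c (rank_one v w) < e"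
    proof -
      have "rank_one v w = rank_one (cutoff F v + cutoff (- F) v) (cutoff F w + cutoff (- F) w)"
        by (simp only: cutoff_decompose)
      also have "\<dots> = ?c + rank_one (cutoff F v) (cutoff (- F) w) + rank_one (cutoff (- F) v) w"
        by (rule blinfun_eqI, subst (5) cutoff_decompose[of F w, symmetric])
          (simp add: rank_one_apply blinfun.add_left cinner_add_right scaleC_add_left scaleC_add_right)
      finally have "rank_one v w - ?c = rank_one (cutoff F v) (cutoff (- F) w) + rank_one (cutoff (- F) v) w"
        by (simp add: algebra_simps)
      then have "dist ?c (rank_one v w)
          = norm (rank_one (cutoff F v) (cutoff (- F) w) + rank_one (cutoff (- F) v) w)"
        by (metis dist_commute dist_norm)
      also have "\<dots> \<le> norm (cutoff F v) * norm (cutoff (- F) w) + norm (cutoff (- F) v) * norm w"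
        by (intro norm_triangle_le add_mono norm_rank_one_le)
      also have "\<dots> \<le> norm v * d + d * norm w"
        using F d by (intro add_mono mult_mono norm_cutoff_apply) auto
      also have "\<dots> < d * (norm v + norm w + 1)"
        using d by (simp add: algebra_simps)
      also have "\<dots> = e" using pos by (simp add: d_def)
      finally show ?thesis .
    qed
    ultimately show ?thesis using rank_one_bounded_operators by blast
  qed
  then have "rank_one v w \<in> band_dominated"
    unfolding band_dominated_def closure_approachable by blast
  then show ?thesis by (simp add: roe_algebra_def entry compact_rank_one)
qed

text \<open>In a uniformly locally finite space a column of a finite propagation operator has finitely
  many nonzero entries. So a column of an element of the Roe algebra is a norm limit of finite sums
  of its own compact entries.\<close>

lemma compact_column:
  fixes a :: "('x::metric_space, 'h::chilbert_space) ell2 \<Rightarrow>\<^sub>L ('x, 'h) ell2"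
  assumes ulf: "uniformly_locally_finite TYPE('x)" and a: "a \<in> roe_algebra"
  shows "compact_operator (a o\<^sub>L delta_op x)"
proof (rule compact_operator_limit)
  fix e :: real
  assume "e > 0"
  then obtain c s where c: "c \<in> bounded_operators" "0 \<le> s" "propagation c \<le> ennreal s" "norm (a - c) < e"
    using roe_algebra_approx[OF a] by blast
  define F where "F = cball x (s + 1)"
  have "0 < s + 1" using \<open>0 \<le> s\<close> by simp
  then have F: "finite F"
    using ulf unfolding F_def uniformly_locally_finite_def by blast
  have "cutoff (- F) (c (delta x \<xi>)) = 0" for \<xi>
  proof (rule ell2_eqI)
    fix y
    have "y \<notin> F \<Longrightarrow> entry c x y = 0"
      using c(3) unfolding propagation_le_iff[OF \<open>0 \<le> s\<close>] by (simp add: F_def)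
    then show "ell2_apply (cutoff (- F) (c (delta x \<xi>))) y = ell2_apply 0 y"
      by (simp add: cutoff_apply zero_ell2.rep_eq flip: entry_apply)
  qed
  then have "(a o\<^sub>L delta_op x) - (cutoff F o\<^sub>L a o\<^sub>L delta_op x) = cutoff (- F) o\<^sub>L (a - c) o\<^sub>L delta_op x"
    by (intro blinfun_eqI)
      (simp add: blinfun.diff_left blinfun.diff_right delta_op_apply flip: cutoff_Compl)
  moreover have "norm (cutoff (- F) o\<^sub>L (a - c) o\<^sub>L delta_op x) \<le> 1 * e * 1"
    using c(4) by (intro norm_blinfun_compose_le norm_cutoff norm_delta_op) simp
  ultimately have "norm ((a o\<^sub>L delta_op x) - (cutoff F o\<^sub>L a o\<^sub>L delta_op x)) \<le> e"
    by simp
  moreover have "cutoff F o\<^sub>L a o\<^sub>L delta_op x = (\<Sum>y\<in>F. delta_op y o\<^sub>L entry a x y)"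
    by (rule blinfun_eqI)
      (simp add: cutoff_finite[OF F] delta_op_apply entry_apply blinfun.sum_left)
  then have "compact_operator (cutoff F o\<^sub>L a o\<^sub>L delta_op x)"
    using a by (simp add: roe_algebra_def compact_operator_sum compact_operator_compose_left)
  ultimately show "\<exists>b. compact_operator b \<and> norm ((a o\<^sub>L delta_op x) - b) \<le> e"
    by blast
qed


section \<open>Isomorphisms of Roe algebras are implemented by unitaries\<close>

text \<open>Conjugation is recorded in both directions: approximation concerns the images of elements of the first
  algebra, while tightness is proved by pulling elements of the second one back.\<close>

locale roe_unitary =
  fixes U :: "('x::metric_space, 'h::chilbert_space) ell2 \<Rightarrow>\<^sub>L ('y::metric_space, 'h) ell2"
    and V :: "('y, 'h) ell2 \<Rightarrow>\<^sub>L ('x, 'h) ell2"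
  assumes U_linear: "U \<in> bounded_operators" and V_linear: "V \<in> bounded_operators"
    and UV: "\<And>w. U (V w) = w" and VU: "\<And>v. V (U v) = v"
    and cinner_U: "\<And>v w. cinner (U v) (U w) = cinner v w"
    and conj_roe: "\<And>a. a \<in> roe_algebra \<Longrightarrow> U o\<^sub>L a o\<^sub>L V \<in> roe_algebra"
    and inv_conj_roe: "\<And>b. b \<in> roe_algebra \<Longrightarrow> V o\<^sub>L b o\<^sub>L U \<in> roe_algebra"

text \<open>Let \<open>e\<close> be the projection onto the line spanned by a unit vector \<open>\<xi>\<close>, and \<open>\<eta>\<close> a unit vector in the
  range of the projection \<open>\<Phi> e\<close>. Every vector \<open>v\<close> is \<open>a \<xi>\<close> for some rank one operator \<open>a\<close> with \<open>a e = a\<close>,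
  and the unitary sends \<open>v\<close> to \<open>\<Phi> a \<eta>\<close>. It preserves inner products because \<open>\<Phi>\<close> maps the scalar multiple
  \<open>a\<^sup>* a\<close> of \<open>e\<close> to the same multiple of \<open>\<Phi> e\<close>; it is onto because the Roe algebra of the target contains
  all rank one operators.\<close>

lemma star_isomorphism_unitary:
  fixes \<Phi> :: "(('x::metric_space, 'h::chilbert_space) ell2 \<Rightarrow>\<^sub>L ('x, 'h) ell2) \<Rightarrow>
      (('y::metric_space, 'h) ell2 \<Rightarrow>\<^sub>L ('y, 'h) ell2)"
  assumes iso: "star_isomorphism roe_algebra roe_algebra \<Phi>" and nontrivial: "(h :: 'h) \<noteq> 0"
  obtains U V where "roe_unitary U V" "\<And>a. a \<in> roe_algebra \<Longrightarrow> \<Phi> a = U o\<^sub>L a o\<^sub>L V"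
proof -
  have bij: "bij_betw \<Phi> roe_algebra roe_algebra"
    and add: "\<And>a b. a \<in> roe_algebra \<Longrightarrow> b \<in> roe_algebra \<Longrightarrow> \<Phi> (a + b) = \<Phi> a + \<Phi> b"
    and scale: "\<And>c a. a \<in> roe_algebra \<Longrightarrow> \<Phi> (c *\<^sub>C a) = c *\<^sub>C \<Phi> a"
    and mult: "\<And>a b. a \<in> roe_algebra \<Longrightarrow> b \<in> roe_algebra \<Longrightarrow> \<Phi> (a o\<^sub>L b) = \<Phi> a o\<^sub>L \<Phi> b"
    and star: "\<And>a. a \<in> roe_algebra \<Longrightarrow> \<Phi> (adj a) = adj (\<Phi> a)"
    using iso by (auto simp: star_isomorphism_def)
  have in_roe: "\<Phi> a \<in> roe_algebra" if "a \<in> roe_algebra" for a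
    using bij that by (rule bij_betw_apply)
  obtain x0 :: 'x where True by simp
  define \<xi> :: "('x, 'h) ell2" where "\<xi> = delta x0 ((1 / norm h) *\<^sub>R h)"
  have "norm \<xi> = 1" using nontrivial by (simp add: \<xi>_def)
  then have cinner_\<xi>: "cinner \<xi> \<xi> = 1" by (simp add: cinner_self)
  define e where "e = rank_one \<xi> \<xi>"
  have e: "e \<in> roe_algebra" by (simp add: e_def rank_one_in_roe_algebra)
  have e_\<xi>: "e \<xi> = \<xi>" by (simp add: e_def rank_one_apply cinner_\<xi> scaleC_one)
  have ee: "e o\<^sub>L e = e"
    by (rule blinfun_eqI)
      (simp add: e_def rank_one_apply cinner_\<xi> scaleC_one cinner_scaleC_left)
  have "rank_one 0 \<xi> = (0 :: ('x, 'h) ell2 \<Rightarrow>\<^sub>L ('x, 'h) ell2)"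
    by (rule blinfun_eqI) (simp add: rank_one_apply complex_vector.scale_zero_right)
  with rank_one_in_roe_algebra[of 0 \<xi>] scale[OF e, of 0]
  have zero: "(0 :: ('x, 'h) ell2 \<Rightarrow>\<^sub>L ('x, 'h) ell2) \<in> roe_algebra" "\<Phi> 0 = 0"
    by (simp_all add: complex_vector.scale_zero_left)
  have "\<Phi> e \<noteq> 0"
  proof
    assume "\<Phi> e = 0"
    then have "e = 0" using zero bij e by (metis bij_betw_imp_inj_on inj_onD)
    then show False using e_\<xi> \<open>norm \<xi> = 1\<close> by simp
  qed
  then obtain \<eta>' where "\<Phi> e \<eta>' \<noteq> 0"
    by (metis blinfun_eqI zero_blinfun.rep_eq)
  define \<eta> where "\<eta> = (1 / norm (\<Phi> e \<eta>')) *\<^sub>R \<Phi> e \<eta>'"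
  have "norm \<eta> = 1" using \<open>\<Phi> e \<eta>' \<noteq> 0\<close> by (simp add: \<eta>_def)
  then have cinner_\<eta>: "cinner \<eta> \<eta> = 1" by (simp add: cinner_self)
  have "\<Phi> e (\<Phi> e \<eta>') = \<Phi> e \<eta>'"
    using mult[OF e e] ee by (metis blinfun_apply_blinfun_compose)
  then have e_\<eta>: "\<Phi> e \<eta> = \<eta>" by (simp add: \<eta>_def blinfun.scaleR_right)

  define u where "u v = \<Phi> (rank_one v \<xi>) \<eta>" for v
  have ro: "rank_one v w \<in> roe_algebra" for v w :: "('z::metric_space, 'h) ell2"
    by (rule rank_one_in_roe_algebra)
  have u_add: "u (v + w) = u v + u w" for v w
  proof -
    have "rank_one (v + w) \<xi> = rank_one v \<xi> + rank_one w \<xi>"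
      by (rule blinfun_eqI) (simp add: rank_one_apply scaleC_add_right blinfun.add_left)
    then show ?thesis by (simp add: u_def add[OF ro ro] blinfun.add_left)
  qed
  have u_scale: "u (c *\<^sub>C v) = c *\<^sub>C u v" for c v
  proof -
    have "rank_one (c *\<^sub>C v) \<xi> = c *\<^sub>C rank_one v \<xi>"
      by (rule blinfun_eqI) (simp add: rank_one_apply scaleC_blinfun.rep_eq scaleC_scaleC mult.commute)
    then show ?thesis by (simp add: u_def scale[OF ro] scaleC_blinfun.rep_eq)
  qed
  have u_cinner: "cinner (u v) (u w) = cinner v w" for v w
  proof -
    have "rank_one \<xi> w o\<^sub>L rank_one v \<xi> = cinner v w *\<^sub>C e"
      by (rule blinfun_eqI)
        (simp add: e_def rank_one_apply scaleC_blinfun.rep_eq scaleC_scaleC cinner_scaleC_left mult.commute)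
    then have "adj (\<Phi> (rank_one w \<xi>)) (u v) = cinner v w *\<^sub>C \<eta>"
      by (simp add: u_def star[OF ro, symmetric] adj_rank_one e_\<eta> scale[OF e] scaleC_blinfun.rep_eq
          mult[OF ro ro, symmetric] flip: blinfun_apply_blinfun_compose)
    then have "cinner (u w) (u v) = cinner \<eta> (cinner v w *\<^sub>C \<eta>)"
      using cinner_adj[OF roe_algebra_bounded_operators[OF in_roe[OF ro]], of w \<xi> \<eta> "u v"]
      by (simp add: u_def)
    then have "cinner (u w) (u v) = cinner w v"
      using cinner_commute[of w v] by (simp add: cinner_scaleC_right cinner_\<eta>)
    then show ?thesis by (metis cinner_commute)
  qed
  have intertwine: "\<Phi> a (u v) = u (a v)" if "a \<in> roe_algebra" for a v
  proof -
    have "a o\<^sub>L rank_one v \<xi> = rank_one (a v) \<xi>"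
      by (rule blinfun_eqI)
        (simp add: rank_one_apply bounded_operators_scaleC[OF roe_algebra_bounded_operators[OF that]])
    then show ?thesis
      using mult[OF that ro[of v \<xi>]] by (simp add: u_def)
  qed
  have u_onto: "\<exists>v. u v = w" for w
  proof -
    obtain a where a: "a \<in> roe_algebra" "\<Phi> a = rank_one w \<eta>"
      using ro[of w \<eta>] bij_betw_imp_surj_on[OF bij] by (metis imageE)
    have "u (a \<xi>) = \<Phi> a (u \<xi>)" using intertwine[OF a(1)] by simp
    also have "u \<xi> = \<eta>" by (simp add: u_def e_\<eta> flip: e_def)
    also have "\<Phi> a \<eta> = w" by (simp add: a rank_one_apply cinner_\<eta> scaleC_one)
    finally show ?thesis by blast
  qed
  then obtain u' where uu': "u (u' w) = w" for w by metis
  have u_norm: "norm (u v) = norm v" for v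
  proof -
    have "complex_of_real ((norm (u v))\<^sup>2) = complex_of_real ((norm v)\<^sup>2)"
      by (simp only: cinner_self[symmetric] u_cinner)
    then show ?thesis by (simp only: of_real_eq_iff) simp
  qed
  have u_inj: "v = w" if "u v = u w" for v w
  proof (rule cinner_ext)
    show "cinner v z = cinner w z" for z
      using that by (metis u_cinner)
  qed
  have u'u: "u' (u v) = v" for v by (rule u_inj) (simp add: uu')
  have u'_add: "u' (v + w) = u' v + u' w" for v w by (rule u_inj) (simp add: uu' u_add)
  have u'_scale: "u' (c *\<^sub>C v) = c *\<^sub>C u' v" for c v by (rule u_inj) (simp add: uu' u_scale)
  have u'_norm: "norm (u' w) = norm w" for w using u_norm[of "u' w"] by (simp add: uu')
  have "bounded_linear u"
    by (rule bounded_linear_intro[where K = 1]) (simp_all add: u_add u_norm scaleR_scaleC u_scale)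
  then have U: "blinfun_apply (Blinfun u) = u" by (rule bounded_linear_Blinfun_apply)
  have "bounded_linear u'"
    by (rule bounded_linear_intro[where K = 1]) (simp_all add: u'_add u'_norm scaleR_scaleC u'_scale)
  then have V: "blinfun_apply (Blinfun u') = u'" by (rule bounded_linear_Blinfun_apply)
  have \<Phi>: "\<Phi> a = Blinfun u o\<^sub>L a o\<^sub>L Blinfun u'" if "a \<in> roe_algebra" for a
    by (rule blinfun_eqI) (simp add: U V intertwine[OF that, symmetric] uu')
  have "roe_unitary (Blinfun u) (Blinfun u')"
  proof
    show "Blinfun u o\<^sub>L a o\<^sub>L Blinfun u' \<in> roe_algebra" if "a \<in> roe_algebra" for a
      using in_roe[OF that] \<Phi>[OF that] by simp
    show "Blinfun u' o\<^sub>L b o\<^sub>L Blinfun u \<in> roe_algebra" if "b \<in> roe_algebra" for b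
    proof -
      have "b \<in> \<Phi> ` roe_algebra"
        using that bij_betw_imp_surj_on[OF bij] by simp
      then obtain a where a: "a \<in> roe_algebra" "b = \<Phi> a" by blast
      have "Blinfun u' o\<^sub>L b o\<^sub>L Blinfun u = a"
        by (rule blinfun_eqI) (simp add: a(2) U V intertwine[OF a(1)] u'u)
      with a show ?thesis by simp
    qed
  qed (simp_all add: U V uu' u'u u_cinner u_scale u'_scale bounded_operators_def)
  with \<Phi> that show thesis by blast
qed


section \<open>Approximation by operators of finite propagation\<close>

lemma id_blinfun_bounded_operators: "id_blinfun \<in> bounded_operators"
  by (simp add: bounded_operators_def)

text \<open>The approximate unit is \<open>p = 1 - (1 - b\<^sup>* b)\<^sup>n\<close>, a polynomial without constant term in the compact operator
  \<open>b\<^sup>* b\<close>. Put \<open>w\<^sub>k = (1 - b\<^sup>* b)\<^sup>k v\<close>. Then \<open>\<parallel>b w\<^sub>k\<parallel>\<^sup>2 \<le> \<parallel>w\<^sub>k\<parallel>\<^sup>2 - \<parallel>w\<^sub>k\<^sub>+\<^sub>1\<parallel>\<^sup>2\<close>, and \<open>\<parallel>b w\<^sub>k\<parallel>\<close> decreases in \<open>k\<close>; the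
  telescoping sum bounds \<open>n \<parallel>b w\<^sub>n\<parallel>\<^sup>2\<close> by \<open>\<parallel>v\<parallel>\<^sup>2\<close>.\<close>

lemma compact_right_approximate_unit:
  fixes b :: "'a::chilbert_space \<Rightarrow>\<^sub>L 'b::chilbert_space"
  assumes b: "b \<in> bounded_operators" "compact_operator b" "norm b \<le> 1" and e: "e > 0"
  shows "\<exists>p\<in>bounded_operators. compact_operator p \<and> norm p \<le> 2 \<and> norm (b - (b o\<^sub>L p)) \<le> e"
proof -
  obtain b' where b': "b' \<in> bounded_operators" "\<And>v w. cinner (b v) w = cinner v (b' w)" "norm b' \<le> norm b"
    using adjoint_exists[OF b(1)] by blast
  have b'_norm: "norm (b' w) \<le> norm w" for w
    using norm_blinfun_apply_le[OF order_trans[OF b'(3) b(3)]] by force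
  have b_norm: "norm (b w) \<le> norm w" for w
    using norm_blinfun_apply_le[OF b(3)] by force
  have inner_b: "inner (b v) w = inner v (b' w)" for v w
    by (simp add: inner_eq_Re_cinner b'(2))
  define R where "R = id_blinfun - (b' o\<^sub>L b)"
  have R_apply: "R w = w - b' (b w)" for w
    by (simp add: R_def blinfun.diff_left)
  have R_bounded: "R \<in> bounded_operators"
    unfolding R_def
    by (intro bounded_operators_diff bounded_operators_compose b b' id_blinfun_bounded_operators)
  have drop: "(norm (b w))\<^sup>2 \<le> (norm w)\<^sup>2 - (norm (R w))\<^sup>2" for w
  proof -
    have "(norm (R w))\<^sup>2 = (norm w)\<^sup>2 - 2 * inner w (b' (b w)) + (norm (b' (b w)))\<^sup>2"
      unfolding R_apply power2_norm_eq_inner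
      by (simp add: inner_diff_left inner_diff_right inner_commute)
    moreover have "inner w (b' (b w)) = (norm (b w))\<^sup>2"
      by (simp add: inner_b[symmetric] power2_norm_eq_inner)
    moreover have "(norm (b' (b w)))\<^sup>2 \<le> (norm (b w))\<^sup>2"
      by (intro power_mono b'_norm) simp
    ultimately show ?thesis by linarith
  qed
  have decr: "(norm (b (R w)))\<^sup>2 \<le> (norm (b w))\<^sup>2" for w
  proof -
    define u where "u = b w"
    have "b (R w) = u - b (b' u)" by (simp add: R_apply u_def blinfun.diff_right)
    then have "(norm (b (R w)))\<^sup>2 = (norm u)\<^sup>2 - 2 * inner (b (b' u)) u + (norm (b (b' u)))\<^sup>2"
      unfolding power2_norm_eq_inner
      by (simp add: inner_diff_left inner_diff_right inner_commute)
    moreover have "inner (b (b' u)) u = (norm (b' u))\<^sup>2"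
      by (simp add: inner_b power2_norm_eq_inner)
    moreover have "(norm (b (b' u)))\<^sup>2 \<le> (norm (b' u))\<^sup>2"
      by (intro power_mono b_norm) simp
    ultimately show ?thesis unfolding u_def[symmetric] using zero_le_power2[of "norm (b' u)"] by linarith
  qed
  define S where "S n = ((\<lambda>q. R o\<^sub>L q) ^^ n) id_blinfun" for n
  have S_0: "S 0 = id_blinfun" and S_Suc: "S (Suc n) = R o\<^sub>L S n" for n
    by (simp_all add: S_def)
  have S_bounded: "S n \<in> bounded_operators" for n
    by (induction n) (simp_all add: S_0 S_Suc id_blinfun_bounded_operators bounded_operators_compose R_bounded)
  have telescope: "real n * (norm (b (S n v)))\<^sup>2 \<le> (norm v)\<^sup>2 - (norm (S n v))\<^sup>2" for n v
  proof (induction n)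
    case 0
    show ?case by (simp add: S_0)
  next
    case (Suc n)
    have "real (Suc n) * (norm (b (S (Suc n) v)))\<^sup>2 \<le> real (Suc n) * (norm (b (S n v)))\<^sup>2"
      unfolding S_Suc blinfun_apply_blinfun_compose by (intro mult_left_mono decr) simp
    also have "\<dots> = real n * (norm (b (S n v)))\<^sup>2 + (norm (b (S n v)))\<^sup>2"
      by (simp add: algebra_simps)
    also have "\<dots> \<le> (norm v)\<^sup>2 - (norm (S (Suc n) v))\<^sup>2"
      using Suc.IH drop[of "S n v"] by (simp add: S_Suc)
    finally show ?case .
  qed
  have compact: "compact_operator (id_blinfun - S n)" for n
  proof (induction n)
    case 0
    show ?case by (simp add: S_0)
  next
    case (Suc n)
    have "id_blinfun - S (Suc n) = (id_blinfun - S n) + ((b' o\<^sub>L b) o\<^sub>L S n)"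
      by (rule blinfun_eqI) (simp add: S_Suc R_apply blinfun.diff_left blinfun.add_left)
    then show ?case
      by (simp only:) (intro compact_operator_add Suc compact_operator_compose_right
          compact_operator_compose_left b(2))
  qed
  have "e\<^sup>2 > 0" using e by simp
  then obtain n where n: "inverse (real (Suc n)) < e\<^sup>2" using reals_Archimedean by blast
  define p where "p = id_blinfun - S (Suc n)"
  have "norm (S (Suc n) v) \<le> norm v" for v
  proof (rule power2_le_imp_le)
    have "0 \<le> real (Suc n) * (norm (b (S (Suc n) v)))\<^sup>2" by simp
    then show "(norm (S (Suc n) v))\<^sup>2 \<le> (norm v)\<^sup>2" using telescope[of "Suc n" v] by linarith
  qed simp
  then have "norm (S (Suc n)) \<le> 1" by (intro norm_blinfun_bound) simp_all
  then have "norm p \<le> 2"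
    unfolding p_def using norm_triangle_ineq4[of id_blinfun "S (Suc n)"] norm_blinfun_id_le[where 'a='a]
    by linarith
  moreover have "norm (b - (b o\<^sub>L p)) \<le> e"
  proof (rule norm_blinfun_bound)
    fix v
    have "(norm (b (S (Suc n) v)))\<^sup>2 \<le> (e * norm v)\<^sup>2"
    proof -
      have "real (Suc n) * (norm (b (S (Suc n) v)))\<^sup>2 \<le> (norm v)\<^sup>2"
        using telescope[of "Suc n" v] zero_le_power2[of "norm (S (Suc n) v)"] by linarith
      then have "(norm (b (S (Suc n) v)))\<^sup>2 \<le> inverse (real (Suc n)) * (norm v)\<^sup>2"
        by (simp add: field_simps)
      also have "\<dots> \<le> e\<^sup>2 * (norm v)\<^sup>2" using n by (intro mult_right_mono) auto
      finally show ?thesis by (simp add: power_mult_distrib)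
    qed
    then have "norm (b (S (Suc n) v)) \<le> e * norm v"
      by (rule power2_le_imp_le) (use e in simp)
    then show "norm ((b - (b o\<^sub>L p)) v) \<le> e * norm v"
      by (simp add: p_def blinfun.diff_left blinfun.diff_right)
  qed (use e in simp)
  moreover have "p \<in> bounded_operators"
    unfolding p_def by (intro bounded_operators_diff id_blinfun_bounded_operators S_bounded)
  ultimately show ?thesis using compact[of "Suc n"] unfolding p_def by blast
qed

lemma uniformly_locally_finite_countable:
  assumes "uniformly_locally_finite TYPE('x::metric_space)"
  shows "countable (UNIV :: 'x set)"
proof -
  obtain x0 :: 'x where True by simp
  have "x \<in> (\<Union>n. cball x0 (real (Suc n)))" for x
  proof -
    obtain n where "dist x0 x \<le> real n" using real_arch_simple by blast
    then have "x \<in> cball x0 (real (Suc n))" by simp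
    then show ?thesis by blast
  qed
  then have "(UNIV :: 'x set) = (\<Union>n. cball x0 (real (Suc n)))" by blast
  moreover have "countable (\<Union>n. cball x0 (real (Suc n)))"
  proof (rule countable_UN)
    have "0 < real (Suc n)" for n by simp
    then have "finite (cball x0 (real (Suc n)))" for n
      using assms unfolding uniformly_locally_finite_def by blast
    then show "countable (cball x0 (real (Suc n)))" for n
      by (rule countable_finite)
  qed simp
  ultimately show ?thesis by simp
qed

text \<open>An element \<open>a\<close> of the Roe algebra is the limit of operators of finite propagation, whose entries are
  arbitrary. Multiplying such an approximant \<open>c\<close> on the right by a diagonal of compact approximate
  units for the columns of \<open>a\<close> makes its entries compact and does not increase its propagation. The same
  multiplication changes \<open>a\<close> only slightly, as the errors in the countably many columns can be
  made summable.\<close>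

lemma approximant_in_roe_algebra:
  fixes a c :: "('x::metric_space, 'h::chilbert_space) ell2 \<Rightarrow>\<^sub>L ('x, 'h) ell2"
  assumes ulf: "uniformly_locally_finite TYPE('x)"
    and a: "a \<in> roe_algebra" "norm a \<le> 1"
    and c: "c \<in> bounded_operators" "propagation c \<le> ennreal s" "norm (a - c) \<le> e"
    and s: "0 \<le> s" and e: "e > 0"
  shows "\<exists>c'\<in>roe_algebra. propagation c' \<le> ennreal s \<and> norm (a - c') \<le> 3 * e"
proof -
  \<comment> \<open>An enumeration of the space, so that column \<open>x\<close> may have error \<open>e / 2 ^ Suc (n x)\<close>.\<close>
  define n :: "'x \<Rightarrow> nat" where "n = to_nat_on UNIV"
  have inj: "inj_on n A" for A
    unfolding n_def by (rule inj_on_subset[OF inj_on_to_nat_on[OF uniformly_locally_finite_countable[OF ulf]]]) simp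
  have "\<exists>p\<in>bounded_operators. compact_operator p \<and> norm p \<le> 2
      \<and> norm ((a o\<^sub>L delta_op x) - ((a o\<^sub>L delta_op x) o\<^sub>L p)) \<le> e * (1/2) ^ Suc (n x)" for x
  proof (rule compact_right_approximate_unit)
    show "a o\<^sub>L delta_op x \<in> bounded_operators"
      by (intro bounded_operators_compose roe_algebra_bounded_operators a delta_op_bounded_operators)
    show "norm (a o\<^sub>L delta_op x) \<le> 1"
      using norm_blinfun_compose_le[OF a(2) norm_delta_op] by simp
  qed (use e in \<open>simp_all add: compact_column[OF ulf a(1)]\<close>)
  then obtain p where p: "\<And>x. p x \<in> bounded_operators" "\<And>x. compact_operator (p x)" "\<And>x. norm (p x) \<le> 2"
    and col: "\<And>x. norm ((a o\<^sub>L delta_op x) - ((a o\<^sub>L delta_op x) o\<^sub>L p x)) \<le> e * (1/2) ^ Suc (n x)"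
    by metis
  define P where "P = diagonal p"
  have P_norm: "norm P \<le> 2" unfolding P_def by (rule norm_diagonal) (rule p)
  have "norm (a - (a o\<^sub>L P)) \<le> e"
  proof (rule norm_blinfun_bound)
    fix v
    define w where "w = v - P v"
    have "norm (a w) \<le> e * norm v + d" if d: "d > 0" for d
    proof -
      obtain F where F: "finite F" "norm (cutoff (- F) w) < d"
        using exists_finite_cutoff[OF d] by (metis order_refl)
      have half: "(\<Sum>x\<in>F. (1/2::real) ^ Suc (n x)) \<le> 1"
      proof -
        have "(\<Sum>x\<in>F. (1/2::real) ^ Suc (n x)) = (\<Sum>k\<in>n ` F. (1/2) ^ Suc k)"
          by (simp add: sum.reindex[OF inj])
        also have "\<dots> \<le> (\<Sum>k. (1/2) ^ Suc k)"
          using F(1) power_half_series by (intro sum_le_suminf) (auto simp: sums_iff)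
        also have "\<dots> = 1" using power_half_series by (simp add: sums_iff)
        finally show ?thesis .
      qed
      have "a (cutoff F w) = (\<Sum>x\<in>F. ((a o\<^sub>L delta_op x) - ((a o\<^sub>L delta_op x) o\<^sub>L p x)) (ell2_apply v x))"
      proof -
        have "delta x (ell2_apply w x) = delta_op x (ell2_apply v x) - delta_op x (p x (ell2_apply v x))" for x
          by (simp add: w_def minus_ell2.rep_eq P_def diagonal_apply[OF p(3)] blinfun.diff_right
              flip: delta_op_apply)
        then show ?thesis
          by (simp add: cutoff_finite[OF F(1)] blinfun.sum_right blinfun.diff_right blinfun.diff_left)
      qed
      then have "norm (a (cutoff F w)) \<le> (\<Sum>x\<in>F. e * (1/2) ^ Suc (n x) * norm (ell2_apply v x))"
        by (simp only:) (intro sum_norm_le norm_blinfun_apply_le col)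
      also have "\<dots> \<le> (\<Sum>x\<in>F. e * (1/2) ^ Suc (n x) * norm v)"
        using e by (intro sum_mono mult_left_mono norm_ell2_apply_le) simp
      also have "\<dots> = e * norm v * (\<Sum>x\<in>F. (1/2) ^ Suc (n x))"
        by (simp add: sum_distrib_left mult_ac)
      also have "\<dots> \<le> e * norm v" using half e by (intro mult_left_le) auto
      finally have "norm (a (cutoff F w)) \<le> e * norm v" .
      moreover have "norm (a (cutoff (- F) w)) \<le> 1 * norm (cutoff (- F) w)"
        by (rule norm_blinfun_apply_le[OF a(2)])
      moreover have "a w = a (cutoff F w) + a (cutoff (- F) w)"
        by (simp only: blinfun.add_right[symmetric] cutoff_decompose)
      ultimately show ?thesis
        using F(2) norm_triangle_ineq[of "a (cutoff F w)" "a (cutoff (- F) w)"] by simp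
    qed
    then have "norm (a w) \<le> e * norm v" by (rule field_le_epsilon)
    then show "norm ((a - (a o\<^sub>L P)) v) \<le> e * norm v"
      by (simp add: w_def blinfun.diff_left blinfun.diff_right)
  qed (use e in simp)
  moreover have "norm ((a - c) o\<^sub>L P) \<le> e * 2"
    by (rule norm_blinfun_compose_le[OF c(3) P_norm])
  moreover have "a - (c o\<^sub>L P) = (a - (a o\<^sub>L P)) + ((a - c) o\<^sub>L P)"
    by (rule blinfun_eqI) (simp add: blinfun.diff_left blinfun.add_left)
  ultimately have "norm (a - (c o\<^sub>L P)) \<le> e + e * 2"
    by (simp only: norm_triangle_mono)
  then have "norm (a - (c o\<^sub>L P)) \<le> 3 * e" by simp
  moreover have entry: "entry (c o\<^sub>L P) x y = entry c x y o\<^sub>L p x" for x y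
    unfolding P_def by (rule entry_compose_diagonal) (rule p)
  then have c_prop: "propagation (c o\<^sub>L P) \<le> ennreal s"
    using c(2) unfolding propagation_le_iff[OF s] by simp
  moreover have "c o\<^sub>L P \<in> roe_algebra"
  proof (rule roe_algebraI[OF _ c_prop])
    show "c o\<^sub>L P \<in> bounded_operators"
      unfolding P_def by (intro bounded_operators_compose c diagonal_bounded_operators[where K = 2] p)
  qed (simp add: entry p compact_operator_compose_left)
  ultimately show ?thesis by blast
qed

text \<open>The entries of \<open>c\<close> may be arbitrary, because compactness of entries is lost in weak limits, under which
  approximability has to be closed.\<close>

definition approximable :: "real \<Rightarrow> real \<Rightarrow> (('x::metric_space, 'h::chilbert_space) ell2 \<Rightarrow>\<^sub>L ('x, 'h) ell2) \<Rightarrow> bool"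
  where "approximable e s b \<longleftrightarrow>
    (\<exists>c\<in>bounded_operators. propagation c \<le> ennreal s \<and> norm (b - c) \<le> e)"

lemma approximable_add:
  assumes "approximable e s a" "approximable e' s' b" "0 \<le> s" "0 \<le> s'"
  shows "approximable (e + e') (max s s') (a + b)"
proof -
  obtain c d where c: "c \<in> bounded_operators" "propagation c \<le> ennreal s" "norm (a - c) \<le> e"
    and d: "d \<in> bounded_operators" "propagation d \<le> ennreal s'" "norm (b - d) \<le> e'"
    using assms(1,2) unfolding approximable_def by blast
  have "norm (a + b - (c + d)) \<le> e + e'"
    using norm_triangle_mono[OF c(3) d(3)] by (simp add: algebra_simps)
  moreover have "propagation (c + d) \<le> ennreal (max s s')"
    using c(2) d(2) assms(3,4) by (simp add: propagation_le_iff entry_add)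
  ultimately show ?thesis
    unfolding approximable_def using bounded_operators_add[OF c(1) d(1)] by blast
qed

lemma approximable_diff:
  assumes "approximable e s a" "approximable e s b" "0 \<le> s"
  shows "approximable (2 * e) s (a - b)"
proof -
  obtain c d where c: "c \<in> bounded_operators" "propagation c \<le> ennreal s" "norm (a - c) \<le> e"
    and d: "d \<in> bounded_operators" "propagation d \<le> ennreal s" "norm (b - d) \<le> e"
    using assms(1,2) unfolding approximable_def by blast
  have "a - b - (c - d) = (a - c) - (b - d)" by simp
  then have "norm (a - b - (c - d)) \<le> norm (a - c) + norm (b - d)"
    by (simp only: norm_triangle_ineq4)
  then have "norm (a - b - (c - d)) \<le> 2 * e"
    using c(3) d(3) by linarith
  moreover have "propagation (c - d) \<le> ennreal s"
    using c(2) d(2) assms(3) by (simp add: propagation_le_iff entry_diff)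
  ultimately show ?thesis
    unfolding approximable_def using bounded_operators_diff[OF c(1) d(1)] by blast
qed


section \<open>Weak limits of compressions\<close>

text \<open>Outside a large finite set both vectors have small norm, so a bounded operator that vanishes on the
  corresponding block has a small matrix coefficient at them.\<close>

lemma tendsto_if_compress_eq:
  fixes a :: "('x, 'h::chilbert_space) ell2 \<Rightarrow>\<^sub>L ('x, 'h) ell2"
  assumes b: "\<And>F. finite F \<Longrightarrow> norm (b F) \<le> K" "\<And>F. finite F \<Longrightarrow> compress F (b F) = compress F a"
  shows "((\<lambda>F. cinner (blinfun_apply (b F) v) w) \<longlongrightarrow> cinner (blinfun_apply a v) w) (finite_subsets_at_top UNIV)"
proof -
  define L where "L = K + norm a"
  let ?f = "\<lambda>F. L * norm v * norm (cutoff (- F) w) + L * norm (cutoff (- F) v) * norm w"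
  have "cmod (cinner (b F v) w - cinner (a v) w) \<le> ?f F" if F: "finite F" for F
  proof -
    define d where "d = b F - a"
    have d: "norm d \<le> L"
      using b(1)[OF F] norm_triangle_ineq4[of "b F" a] by (simp add: d_def L_def)
    then have L: "0 \<le> L" by (rule order_trans[OF norm_ge_zero])
    have "compress F d v = compress F (b F) v - compress F a v"
      by (simp add: d_def compress_apply blinfun.diff_left blinfun.diff_right)
    then have "compress F d v = 0" by (simp add: b(2)[OF F])
    then have 0: "cinner (d (cutoff F v)) (cutoff F w) = 0"
      by (simp add: compress_apply flip: cinner_cutoff)
    have "cinner (d v) w = cinner (d (cutoff F v + cutoff (- F) v)) w"
      by (simp only: cutoff_decompose)
    also have "\<dots> = cinner (d (cutoff F v)) w + cinner (d (cutoff (- F) v)) w"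
      by (simp only: blinfun.add_right cinner_add_left)
    also have "\<dots> = cinner (d (cutoff F v)) (cutoff F w + cutoff (- F) w) + cinner (d (cutoff (- F) v)) w"
      by (simp only: cutoff_decompose)
    also have "\<dots> = cinner (d (cutoff F v)) (cutoff (- F) w) + cinner (d (cutoff (- F) v)) w"
      by (simp only: cinner_add_right 0) simp
    finally have "cmod (cinner (d v) w)
        \<le> norm (d (cutoff F v)) * norm (cutoff (- F) w) + norm (d (cutoff (- F) v)) * norm w"
      by (simp only:) (intro norm_triangle_mono cmod_cinner_le)
    also have "\<dots> \<le> ?f F"
    proof (intro add_mono mult_right_mono)
      have "norm (d (cutoff F v)) \<le> L * norm (cutoff F v)" by (rule norm_blinfun_apply_le[OF d])
      also have "\<dots> \<le> L * norm v" using L by (intro mult_left_mono norm_cutoff_apply)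
      finally show "norm (d (cutoff F v)) \<le> L * norm v" .
    qed (simp_all add: norm_blinfun_apply_le[OF d])
    finally show ?thesis by (simp add: d_def blinfun.diff_left cinner_diff_left)
  qed
  then have "\<forall>\<^sub>F F in finite_subsets_at_top UNIV. norm (cinner (b F v) w - cinner (a v) w) \<le> ?f F"
    by (intro eventually_finite_subsets_at_top_weakI) simp
  moreover have "(?f \<longlongrightarrow> L * norm v * 0 + L * 0 * norm w) (finite_subsets_at_top UNIV)"
    by (intro tendsto_intros tendsto_cutoff_Compl)
  then have "(?f \<longlongrightarrow> 0) (finite_subsets_at_top UNIV)" by simp
  ultimately have "((\<lambda>F. cinner (b F v) w - cinner (a v) w) \<longlongrightarrow> 0) (finite_subsets_at_top UNIV)"
    by (rule Lim_null_comparison)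
  then show ?thesis by (rule LIM_zero_cancel)
qed

lemma entry_eqI:
  fixes a b :: "('x, 'h::chilbert_space) ell2 \<Rightarrow>\<^sub>L ('x, 'h) ell2"
  assumes "\<And>x y. entry a x y = entry b x y"
  shows "a = b"
proof (intro blinfun_eqI cinner_ext)
  fix v w
  have "((\<lambda>F. cinner (a v) w) \<longlongrightarrow> cinner (b v) w) (finite_subsets_at_top (UNIV :: 'x set))"
    by (rule tendsto_if_compress_eq[where b = "\<lambda>_. a" and K = "norm a"])
      (simp, rule compress_eqI, assumption, rule assms)
  then show "cinner (a v) w = cinner (b v) w"
    by (simp add: tendsto_const_iff)
qed


section \<open>The unitary is tight on finite sets\<close>

lemma norm_cutoff_mono:
  assumes "A \<subseteq> B"
  shows "norm (cutoff A v) \<le> norm (cutoff B v)"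
proof -
  have "cutoff A v = cutoff A (cutoff B v)"
    using assms by (simp add: cutoff_cutoff inf.absorb1)
  then show ?thesis using norm_cutoff_apply[of A "cutoff B v"] by simp
qed

text \<open>A finite set cuts off the tails of the finitely many centres of the net, hence of all vectors near
  them.\<close>

lemma tails_of_finite_net_uniform:
  fixes S :: "('x, 'h::chilbert_space) ell2 set"
  assumes "finite_net e S" "e > 0"
  obtains A where "finite A" "\<And>v B. v \<in> S \<Longrightarrow> B \<inter> A = {} \<Longrightarrow> norm (cutoff B v) < 2 * e"
proof -
  obtain k where k: "finite k" "S \<subseteq> (\<Union>c\<in>k. ball c e)"
    using assms(1) unfolding finite_net_def by blast
  have "\<exists>A. finite A \<and> norm (cutoff (- A) c) < e" for c :: "('x, 'h) ell2"
    using exists_finite_cutoff[OF assms(2), of c] by (metis order_refl)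
  then obtain T :: "('x, 'h) ell2 \<Rightarrow> 'x set" where T: "\<And>c. finite (T c)" "\<And>c. norm (cutoff (- T c) c) < e"
    by metis
  show thesis
  proof (rule that)
    show "finite (\<Union>c\<in>k. T c)" using k(1) T(1) by simp
    fix v B
    assume "v \<in> S" and B: "B \<inter> (\<Union>c\<in>k. T c) = {}"
    then obtain c where c: "c \<in> k" "dist c v < e" using k(2) by auto
    have "cutoff B v = cutoff B c + cutoff B (v - c)"
      by (simp add: blinfun.diff_right)
    then have "norm (cutoff B v) \<le> norm (cutoff B c) + norm (cutoff B (v - c))"
      by (simp only: norm_triangle_ineq)
    moreover have "norm (cutoff B c) \<le> norm (cutoff (- T c) c)"
      using B c(1) by (intro norm_cutoff_mono) auto
    moreover have "norm (cutoff B (v - c)) \<le> norm (v - c)" by (rule norm_cutoff_apply)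
    moreover have "norm (v - c) < e" using c(2) by (simp add: dist_norm norm_minus_commute)
    ultimately show "norm (cutoff B v) < 2 * e" using T(2)[of c] by linarith
  qed
qed

context roe_unitary
begin

lemma norm_U: "norm (U v) = norm v"
proof -
  have "complex_of_real ((norm (U v))\<^sup>2) = complex_of_real ((norm v)\<^sup>2)"
    by (simp only: cinner_self[symmetric] cinner_U)
  then show ?thesis by (simp only: of_real_eq_iff) simp
qed

lemma norm_V: "norm (V w) = norm w"
  using norm_U[of "V w"] by (simp add: UV)

lemma norm_U_le: "norm U \<le> 1"
  by (rule norm_blinfun_bound) (simp_all add: norm_U)

lemma norm_V_le: "norm V \<le> 1"
  by (rule norm_blinfun_bound) (simp_all add: norm_V)

lemma cinner_V: "cinner (V w) v = cinner w (U v)"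
  using cinner_U[of "V w" v] by (simp add: UV)

definition Ad :: "(('x, 'h) ell2 \<Rightarrow>\<^sub>L ('x, 'h) ell2) \<Rightarrow> ('y, 'h) ell2 \<Rightarrow>\<^sub>L ('y, 'h) ell2" where
  "Ad a = U o\<^sub>L a o\<^sub>L V"

lemma Ad_apply: "blinfun_apply (Ad a) w = U (a (V w))"
  by (simp add: Ad_def)

lemma Ad_add: "Ad (a + b) = Ad a + Ad b"
  by (rule blinfun_eqI) (simp add: Ad_apply blinfun.add_left blinfun.add_right)

lemma Ad_diff: "Ad (a - b) = Ad a - Ad b"
  by (rule blinfun_eqI) (simp add: Ad_apply blinfun.diff_left blinfun.diff_right)

lemma norm_Ad: "norm a \<le> K \<Longrightarrow> norm (Ad a) \<le> K"
  using norm_blinfun_compose_le[OF norm_blinfun_compose_le[OF norm_U_le, of a K] norm_V_le]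
  by (simp add: Ad_def)

lemma Ad_bounded_operators: "a \<in> bounded_operators \<Longrightarrow> Ad a \<in> bounded_operators"
  unfolding Ad_def by (intro bounded_operators_compose U_linear V_linear)

lemma Ad_roe_algebra: "a \<in> roe_algebra \<Longrightarrow> Ad a \<in> roe_algebra"
  unfolding Ad_def by (rule conj_roe)

text \<open>If \<open>U\<close> spread the unit ball of \<open>\<delta>\<^sub>x \<otimes> H\<close> over infinitely many places, there would be vectors \<open>\<xi>\<^sub>n\<close>
  in the unit ball of \<open>H\<close> and disjoint finite sets \<open>D\<^sub>n\<close> such that the part of \<open>U (\<delta>\<^sub>x \<otimes> \<xi>\<^sub>n)\<close> in \<open>D\<^sub>n\<close> is bounded
  below. The diagonal operator \<open>P\<close> with entry at \<open>z \<in> D\<^sub>n\<close> the projection onto the line of the value of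
  \<open>U (\<delta>\<^sub>x \<otimes> \<xi>\<^sub>n)\<close> at \<open>z\<close> belongs to the Roe algebra and fixes all these parts. But \<open>V P U\<close> belongs to the
  Roe algebra as well, so its column at \<open>x\<close> is compact, and the vectors \<open>P U (\<delta>\<^sub>x \<otimes> \<xi>\<^sub>n)\<close> have uniformly
  small tails. For large \<open>n\<close> the set \<open>D\<^sub>n\<close> lies in the tail, contrary to the lower bound.\<close>

lemma tight_column:
  assumes ulf: "uniformly_locally_finite TYPE('x)" and e: "e > 0"
  shows "\<exists>F. finite F \<and> norm (cutoff (- F) o\<^sub>L U o\<^sub>L delta_op x) \<le> e"
proof (rule ccontr)
  assume "\<not> ?thesis"
  then have large: "e < norm (cutoff (- F) o\<^sub>L U o\<^sub>L delta_op x)" if "finite F" for F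
    using that by (auto simp: not_le)
  define Q where "Q F F' \<longleftrightarrow> F \<subseteq> F' \<and> (\<exists>\<xi>. norm \<xi> \<le> 1 \<and> e < norm (cutoff (F' - F) (U (delta x \<xi>))))"
    for F F' :: "'y set"
  have step: "\<exists>F'. finite F' \<and> Q F F'" if F: "finite F" for F
  proof -
    define b where "b = cutoff (- F) o\<^sub>L U o\<^sub>L delta_op x"
    have "\<exists>\<xi>. e * norm \<xi> < norm (b \<xi>)"
    proof (rule ccontr)
      assume "\<not> ?thesis"
      then have "norm b \<le> e" using e by (intro norm_blinfun_bound) (auto simp: not_less)
      then show False using large[OF F] by (simp add: b_def)
    qed
    then obtain \<zeta> where \<zeta>: "e * norm \<zeta> < norm (b \<zeta>)" by blast
    then have "\<zeta> \<noteq> 0" by auto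
    define \<xi> where "\<xi> = (1 / norm \<zeta>) *\<^sub>R \<zeta>"
    have "norm \<xi> = 1" using \<open>\<zeta> \<noteq> 0\<close> by (simp add: \<xi>_def)
    have "e < norm (b \<xi>)"
      using \<zeta> \<open>\<zeta> \<noteq> 0\<close> by (simp add: \<xi>_def blinfun.scaleR_right field_simps)
    define g where "g = cutoff (- F) (U (delta x \<xi>))"
    have g: "e < norm g"
      using \<open>e < norm (b \<xi>)\<close> by (simp add: b_def g_def delta_op_apply)
    then have "0 < norm g - e" by simp
    then obtain A where A: "finite A" "\<And>F'. finite F' \<Longrightarrow> A \<subseteq> F' \<Longrightarrow> norm (cutoff (- F') g) < norm g - e"
      using exists_finite_cutoff by blast
    have "norm (cutoff (- (F \<union> A)) g) < norm g - e"
      using A(1) F by (intro A(2)) auto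
    moreover have "norm g \<le> norm (cutoff (F \<union> A) g) + norm (cutoff (- (F \<union> A)) g)"
      using norm_triangle_ineq[of "cutoff (F \<union> A) g" "cutoff (- (F \<union> A)) g"] by (simp only: cutoff_decompose)
    ultimately have "e < norm (cutoff (F \<union> A) g)" by linarith
    moreover have "cutoff (F \<union> A) g = cutoff (F \<union> A - F) (U (delta x \<xi>))"
      by (simp add: g_def cutoff_cutoff Diff_eq)
    ultimately have "Q F (F \<union> A)"
      unfolding Q_def using \<open>norm \<xi> = 1\<close> by (intro conjI exI[of _ \<xi>]) auto
    then show ?thesis using A(1) F by blast
  qed
  have "\<exists>G. \<forall>n. finite (G n) \<and> Q (G n) (G (Suc n))"
    by (rule dependent_nat_choice) (use step in auto)
  then obtain G where G: "\<And>n. finite (G n)" "\<And>n. Q (G n) (G (Suc n))" by blast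
  then have "\<And>n. G n \<subseteq> G (Suc n)" by (simp add: Q_def)
  then have mono: "G m \<subseteq> G n" if "m \<le> n" for m n
    using that by (rule lift_Suc_mono_le)
  have "\<exists>\<xi>. norm \<xi> \<le> 1 \<and> e < norm (cutoff (G (Suc n) - G n) (U (delta x \<xi>)))" for n
    using G(2)[of n] by (simp add: Q_def)
  then obtain \<xi> where \<xi>: "\<And>n. norm (\<xi> n) \<le> 1"
    and big: "\<And>n. e < norm (cutoff (G (Suc n) - G n) (U (delta x (\<xi> n))))"
    by metis
  define f where "f n = U (delta x (\<xi> n))" for n
  \<comment> \<open>As \<open>G\<close> increases, the least index selects the difference that contains \<open>z\<close>.\<close>
  define stage where "stage z = (LEAST n. z \<in> G (Suc n))" for z
  have stage: "stage z = n" if z: "z \<in> G (Suc n) - G n" for z n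
    unfolding stage_def
  proof (rule Least_equality)
    show "n \<le> m" if "z \<in> G (Suc m)" for m
    proof (rule ccontr)
      assume "\<not> n \<le> m"
      then have "G (Suc m) \<subseteq> G n" by (intro mono) simp
      then show False using that z by blast
    qed
  qed (use z in blast)
  \<comment> \<open>Where the vector vanishes, \<open>sgn 0 = 0\<close> makes the entry of \<open>P\<close> the zero operator.\<close>
  define u where "u z = sgn (ell2_apply (f (stage z)) z)" for z
  define p where "p z = rank_one (u z) (u z)" for z
  have "norm (u z) \<le> 1" for z by (simp add: u_def norm_sgn)
  then have p_norm: "norm (p z) \<le> 1" for z
    unfolding p_def using norm_rank_one_le[of "u z" "u z"] mult_le_one[of "norm (u z)" "norm (u z)"]
    by (meson norm_ge_zero order_trans)
  have fixed: "rank_one (sgn w) (sgn w) w = w" for w :: 'h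
  proof (cases "w = 0")
    case False
    have "cinner w (sgn w) = complex_of_real (norm w)"
      using False
      by (simp add: sgn_div_norm scaleR_scaleC cinner_scaleC_right cinner_self power2_eq_square)
    then show ?thesis
      using False by (simp add: rank_one_apply sgn_div_norm flip: scaleR_scaleC)
  qed (simp add: blinfun.zero_right)
  define P where "P = diagonal p"
  have P_roe: "P \<in> roe_algebra"
  proof (rule roe_algebraI[where s = 0])
    show "P \<in> bounded_operators"
      unfolding P_def by (rule diagonal_bounded_operators[OF p_norm]) (simp add: p_def rank_one_bounded_operators)
    show "propagation P \<le> ennreal 0"
      unfolding propagation_le_iff[OF order_refl] by (auto simp: P_def entry_diagonal[OF p_norm])
    show "compact_operator (entry P x y)" for x y
      by (simp add: P_def entry_diagonal[OF p_norm] p_def compact_rank_one)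
  qed
  have P_f: "cutoff (G (Suc n) - G n) (P (f n)) = cutoff (G (Suc n) - G n) (f n)" for n
  proof (rule ell2_eqI)
    show "ell2_apply (cutoff (G (Suc n) - G n) (P (f n))) z = ell2_apply (cutoff (G (Suc n) - G n) (f n)) z" for z
    proof (cases "z \<in> G (Suc n) - G n")
      case True
      then show ?thesis
        by (simp add: cutoff_apply P_def diagonal_apply[OF p_norm] p_def u_def stage fixed)
    next
      case False
      then show ?thesis by (simp only: cutoff_apply if_False)
    qed
  qed
  have "compact_operator (U o\<^sub>L ((V o\<^sub>L P o\<^sub>L U) o\<^sub>L delta_op x))"
    by (intro compact_operator_compose_left compact_column[OF ulf] inv_conj_roe P_roe)
  moreover have "U o\<^sub>L ((V o\<^sub>L P o\<^sub>L U) o\<^sub>L delta_op x) = P o\<^sub>L U o\<^sub>L delta_op x"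
    by (rule blinfun_eqI) (simp add: UV)
  ultimately have "finite_net (e/2) (blinfun_apply (P o\<^sub>L U o\<^sub>L delta_op x) ` cball 0 1)"
    using e by (simp add: compact_operator_iff)
  then obtain A where A: "finite A"
    "\<And>v B. v \<in> blinfun_apply (P o\<^sub>L U o\<^sub>L delta_op x) ` cball 0 1 \<Longrightarrow> B \<inter> A = {} \<Longrightarrow> norm (cutoff B v) < 2 * (e/2)"
    using tails_of_finite_net_uniform[of "e/2"] e by (metis half_gt_zero)
  \<comment> \<open>The differences \<open>G (Suc n) - G n\<close> are disjoint, so one of them misses the finite set \<open>A\<close>.\<close>
  obtain N where N: "A \<inter> (\<Union>n. G n) \<subseteq> G N"
  proof -
    have "\<forall>z\<in>A \<inter> (\<Union>n. G n). \<exists>n. z \<in> G n" by blast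
    then obtain m where m: "\<And>z. z \<in> A \<inter> (\<Union>n. G n) \<Longrightarrow> z \<in> G (m z)" by metis
    define N where "N = Max (insert 0 (m ` (A \<inter> (\<Union>n. G n))))"
    have "m z \<le> N" if "z \<in> A \<inter> (\<Union>n. G n)" for z
      unfolding N_def using that A(1) by (intro Max_ge) auto
    then have "A \<inter> (\<Union>n. G n) \<subseteq> G N" using m mono by blast
    then show thesis by (rule that)
  qed
  have "(G (Suc N) - G N) \<inter> A = {}" using N by blast
  moreover have "P (f N) \<in> blinfun_apply (P o\<^sub>L U o\<^sub>L delta_op x) ` cball 0 1"
    using \<xi>[of N] by (intro image_eqI[of _ _ "\<xi> N"]) (simp_all add: f_def delta_op_apply)
  ultimately have "norm (cutoff (G (Suc N) - G N) (P (f N))) < e"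
    using A(2) by fastforce
  then show False using big[of N] by (simp only: P_f f_def[symmetric])
qed

text \<open>The errors of the finitely many columns add up. The second estimate is the adjoint of the first, as
  \<open>V\<close> is the adjoint of \<open>U\<close>.\<close>

lemma tight:
  assumes ulf: "uniformly_locally_finite TYPE('x)" and e: "e > 0" and G: "finite G"
  shows "\<exists>F. finite F \<and> norm (cutoff (- F) o\<^sub>L U o\<^sub>L cutoff G) \<le> e \<and> norm (cutoff G o\<^sub>L V o\<^sub>L cutoff (- F)) \<le> e"
proof -
  define d where "d = e / (real (card G) + 1)"
  have pos: "real (card G) + 1 > 0" by simp
  have d: "d > 0" unfolding d_def using e pos by (rule divide_pos_pos)
  obtain T where T: "\<And>x. finite (T x)" "\<And>x. norm (cutoff (- T x) o\<^sub>L U o\<^sub>L delta_op x) \<le> d"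
    using tight_column[OF ulf d] by metis
  define F where "F = (\<Union>x\<in>G. T x)"
  have F: "finite F" unfolding F_def using G T(1) by simp
  have UG: "norm (cutoff (- F) (U (cutoff G v))) \<le> e * norm v" for v
  proof -
    have "cutoff (- F) (U (cutoff G v)) = (\<Sum>x\<in>G. cutoff (- F) (U (delta x (ell2_apply v x))))"
      by (simp add: cutoff_finite[OF G] blinfun.sum_right)
    also have "norm \<dots> \<le> (\<Sum>x\<in>G. d * norm v)"
    proof (rule sum_norm_le)
      fix x assume x: "x \<in> G"
      have "norm (cutoff (- F) (U (delta x (ell2_apply v x)))) \<le> norm (cutoff (- T x) (U (delta x (ell2_apply v x))))"
        using x by (intro norm_cutoff_mono) (auto simp: F_def)
      also have "\<dots> = norm ((cutoff (- T x) o\<^sub>L U o\<^sub>L delta_op x) (ell2_apply v x))"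
        by (simp add: delta_op_apply)
      also have "\<dots> \<le> d * norm (ell2_apply v x)" by (rule norm_blinfun_apply_le[OF T(2)])
      also have "\<dots> \<le> d * norm v" using d by (intro mult_left_mono norm_ell2_apply_le) simp
      finally show "norm (cutoff (- F) (U (delta x (ell2_apply v x)))) \<le> d * norm v" .
    qed
    also have "\<dots> = (real (card G) * d) * norm v" by simp
    also have "\<dots> \<le> e * norm v"
    proof (rule mult_right_mono)
      have "real (card G) * d \<le> (real (card G) + 1) * d" using d by (simp add: algebra_simps)
      also have "\<dots> = e" using pos by (simp add: d_def)
      finally show "real (card G) * d \<le> e" .
    qed simp
    finally show ?thesis .
  qed
  have VG: "norm (cutoff G (V (cutoff (- F) w))) \<le> e * norm w" for w
  proof -
    define z where "z = cutoff G (V (cutoff (- F) w))"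
    have "cutoff G z = z" by (simp add: z_def cutoff_cutoff)
    then have "cinner z z = cinner w (cutoff (- F) (U (cutoff G z)))"
      by (metis z_def cinner_cutoff cinner_V)
    then have "(norm z)\<^sup>2 = cmod (cinner w (cutoff (- F) (U (cutoff G z))))"
      by (metis cinner_self norm_of_real abs_power2 real_norm_def)
    also have "\<dots> \<le> norm w * norm (cutoff (- F) (U (cutoff G z)))" by (rule cmod_cinner_le)
    also have "\<dots> \<le> norm w * (e * norm z)" by (intro mult_left_mono UG) simp
    finally show ?thesis
      unfolding z_def[symmetric] using e by (cases "z = 0") (auto simp: power2_eq_square mult_ac)
  qed
  have "norm (cutoff (- F) o\<^sub>L U o\<^sub>L cutoff G) \<le> e"
    using e UG by (intro norm_blinfun_bound) simp_all
  moreover have "norm (cutoff G o\<^sub>L V o\<^sub>L cutoff (- F)) \<le> e"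
    using e VG by (intro norm_blinfun_bound) simp_all
  ultimately show ?thesis using F by blast
qed

end


section \<open>A Baire category argument\<close>

definition banded_contractions :: "real \<Rightarrow> (('x::metric_space, 'h::chilbert_space) ell2 \<Rightarrow>\<^sub>L ('x, 'h) ell2) set" where
  "banded_contractions r = {a \<in> bounded_operators. norm a \<le> 1 \<and> propagation a \<le> ennreal r
    \<and> (\<forall>x y. compact_operator (entry a x y))}"

lemma banded_contractions_roe_algebra: "a \<in> banded_contractions r \<Longrightarrow> a \<in> roe_algebra"
  unfolding banded_contractions_def by (auto intro: roe_algebraI)

lemma compress_compress: "compress A (compress B a) = compress (A \<inter> B) a"
  by (rule blinfun_eqI) (simp add: compress_apply cutoff_cutoff Int_commute)

lemma compress_banded_contractions:
  assumes "a \<in> banded_contractions r" "0 \<le> r"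
  shows "compress A a \<in> banded_contractions r"
  using assms order_trans[OF norm_compress]
  by (auto simp: banded_contractions_def compress_bounded_operators propagation_le_iff entry_compress)

text \<open>The two blocks act on orthogonal subspaces, so the norm of the sum is the larger of their norms.\<close>

lemma glue_banded_contractions:
  fixes a b :: "('x::metric_space, 'h::chilbert_space) ell2 \<Rightarrow>\<^sub>L ('x, 'h) ell2"
  assumes a: "a \<in> banded_contractions r" and b: "b \<in> banded_contractions r" and r: "0 \<le> r"
  shows "compress F a + compress (- F) b \<in> banded_contractions r"
proof -
  define t where "t = compress F a + compress (- F) b"
  have "norm (t v) \<le> 1 * norm v" for v
  proof (rule power2_le_imp_le)
    have part: "norm (compress A c v) \<le> norm (cutoff A v)"
      if "c \<in> banded_contractions r" for c :: "('x, 'h) ell2 \<Rightarrow>\<^sub>L ('x, 'h) ell2" and A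
    proof -
      have "norm c \<le> 1" using that by (simp add: banded_contractions_def)
      have "norm (compress A c v) \<le> norm (c (cutoff A v))"
        unfolding compress_apply by (rule norm_cutoff_apply)
      also have "\<dots> \<le> 1 * norm (cutoff A v)" by (rule norm_blinfun_apply_le) fact
      finally show ?thesis by simp
    qed
    have "cutoff F (t v) = compress F a v"
      by (rule ell2_eqI) (simp add: t_def compress_apply blinfun.add_left plus_ell2.rep_eq cutoff_apply)
    moreover have "cutoff (- F) (t v) = compress (- F) b v"
      by (rule ell2_eqI) (simp add: t_def compress_apply blinfun.add_left plus_ell2.rep_eq cutoff_apply)
    ultimately have "(norm (t v))\<^sup>2 = (norm (compress F a v))\<^sup>2 + (norm (compress (- F) b v))\<^sup>2"
      using norm_cutoff_sum_sq[of "t v" F] by simp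
    also have "\<dots> \<le> (norm (cutoff F v))\<^sup>2 + (norm (cutoff (- F) v))\<^sup>2"
      by (intro add_mono power_mono part a b) simp_all
    also have "\<dots> = (norm v)\<^sup>2" by (rule norm_cutoff_sum_sq[symmetric])
    finally show "(norm (t v))\<^sup>2 \<le> (1 * norm v)\<^sup>2" by simp
  qed simp
  then have "norm t \<le> 1" by (intro norm_blinfun_bound) simp_all
  then show ?thesis
    using compress_banded_contractions[OF a r, of F] compress_banded_contractions[OF b r, of "- F"]
    unfolding t_def[symmetric]
    by (auto simp: banded_contractions_def t_def bounded_operators_add propagation_le_iff[OF r] entry_add
        compact_operator_add)
qed

lemma entry_weak_limit_zero:
  assumes G: "G \<noteq> bot"
    and lim: "\<And>v w. ((\<lambda>i. cinner (blinfun_apply (c i) v) w) \<longlongrightarrow> cinner (blinfun_apply b v) w) G"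
    and zero: "\<forall>\<^sub>F i in G. entry (c i) x y = 0"
  shows "entry b x y = 0"
proof (intro blinfun_eqI cinner_ext)
  fix \<xi> \<eta>
  have "\<forall>\<^sub>F i in G. cinner (c i (delta x \<xi>)) (delta y \<eta>) = 0"
    using zero by eventually_elim (simp flip: cinner_entry)
  then have "((\<lambda>i. cinner (c i (delta x \<xi>)) (delta y \<eta>)) \<longlongrightarrow> 0) G"
    by (rule tendsto_eventually)
  then have "cinner (b (delta x \<xi>)) (delta y \<eta>) = 0"
    using tendsto_unique[OF G lim] by blast
  then show "cinner (entry b x y \<xi>) \<eta> = cinner (blinfun_apply 0 \<xi>) \<eta>"
    by (simp add: cinner_entry)
qed

context roe_unitary
begin

text \<open>Approximability with fixed \<open>e\<close> and \<open>s\<close> is closed under weak limits, as the approximants have a weak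
  cluster point. So its failure is witnessed by a finite block of the matrix.\<close>

lemma approximable_closed:
  assumes e: "0 \<le> e" and s: "0 \<le> s" and a: "norm a \<le> 1"
    and approx: "\<And>F. finite F \<Longrightarrow> \<exists>b. norm b \<le> 1 \<and> compress F b = compress F a \<and> approximable e s (Ad b)"
  shows "approximable e s (Ad a)"
proof -
  have "\<exists>b c. norm b \<le> 1 \<and> compress F b = compress F a
      \<and> c \<in> bounded_operators \<and> propagation c \<le> ennreal s \<and> norm (Ad b - c) \<le> e" if "finite F" for F
    using approx[OF that] unfolding approximable_def by blast
  then obtain b c where b: "\<And>F. finite F \<Longrightarrow> norm (b F) \<le> 1" "\<And>F. finite F \<Longrightarrow> compress F (b F) = compress F a"
    and c: "\<And>F. finite F \<Longrightarrow> c F \<in> bounded_operators" "\<And>F. finite F \<Longrightarrow> propagation (c F) \<le> ennreal s"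
      "\<And>F. finite F \<Longrightarrow> norm (Ad (b F) - c F) \<le> e"
    by metis
  have c_norm: "norm (c F) \<le> 1 + e" if "finite F" for F
    using norm_Ad[OF b(1)[OF that]] c(3)[OF that] norm_triangle_ineq4[of "Ad (b F)" "Ad (b F) - c F"]
    by simp
  have fin: "\<forall>\<^sub>F F in finite_subsets_at_top UNIV. finite (F :: 'x set)"
    by (rule eventually_finite_subsets_at_top_weakI)
  have "\<forall>\<^sub>F F in finite_subsets_at_top UNIV. c F \<in> bounded_operators \<and> norm (c F) \<le> 1 + e"
    using fin by eventually_elim (simp add: c(1) c_norm)
  from weak_operator_cluster_point[OF finite_subsets_at_top_neq_bot this]
  obtain G c0 where G: "G \<le> finite_subsets_at_top UNIV" "G \<noteq> bot"
    and c0: "c0 \<in> bounded_operators" "norm c0 \<le> 1 + e"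
    and lim: "\<And>v w. ((\<lambda>F. cinner (blinfun_apply (c F) v) w) \<longlongrightarrow> cinner (blinfun_apply c0 v) w) G"
    by blast
  have finG: "\<forall>\<^sub>F F in G. finite F" by (rule filter_leD[OF G(1) fin])
  have "propagation c0 \<le> ennreal s"
    unfolding propagation_le_iff[OF s]
  proof (intro allI impI)
    fix x y :: 'y assume xy: "s < dist x y"
    have "\<forall>\<^sub>F F in G. entry (c F) x y = 0"
      using finG
    proof eventually_elim
      case (elim F)
      then show ?case using c(2)[OF elim] xy unfolding propagation_le_iff[OF s] by blast
    qed
    with G(2) lim show "entry c0 x y = 0" by (rule entry_weak_limit_zero)
  qed
  moreover have "norm (Ad a - c0) \<le> e"
  proof (rule norm_le_if_weak_limit[OF G(2) e])
    fix v w
    have "((\<lambda>F. cinner (b F (V v)) (V w)) \<longlongrightarrow> cinner (a (V v)) (V w)) (finite_subsets_at_top UNIV)"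
      by (rule tendsto_if_compress_eq[OF b])
    then have "((\<lambda>F. cinner (Ad (b F) v) w) \<longlongrightarrow> cinner (Ad a v) w) (finite_subsets_at_top UNIV)"
      using cinner_U[of _ "V w"] by (simp add: Ad_apply UV)
    then have "((\<lambda>F. cinner (Ad (b F) v) w) \<longlongrightarrow> cinner (Ad a v) w) G"
      by (rule tendsto_mono[OF G(1)])
    from tendsto_diff[OF this lim]
    show "((\<lambda>F. cinner ((Ad (b F) - c F) v) w) \<longlongrightarrow> cinner ((Ad a - c0) v) w) G"
      by (simp add: blinfun.diff_left cinner_diff_left)
    show "\<forall>\<^sub>F F in G. norm (Ad (b F) - c F) \<le> e"
      using finG by eventually_elim (rule c(3))
  qed
  ultimately show ?thesis unfolding approximable_def using c0 by blast
qed

text \<open>Baire's theorem for the contractions of propagation at most \<open>r\<close>, in the topology in which agreement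
  on finite blocks is a base of neighbourhoods: these contractions are the union over \<open>n\<close> of the closed
  sets of those whose image is approximable with propagation \<open>n\<close>. If none of these sets had interior
  points, one could choose finite blocks successively, the \<open>n\<close>-th one preventing approximation with
  propagation \<open>n\<close>. An operator with all these blocks exists by weak compactness, and its entries are
  compact as they are entries of the blocks.\<close>

lemma approximable_interior:
  assumes r: "0 \<le> r" and e: "e > 0"
  shows "\<exists>F n a0. finite F \<and> a0 \<in> banded_contractions r \<and>
    (\<forall>a\<in>banded_contractions r. compress F a = compress F a0 \<longrightarrow> approximable e (real n) (Ad a))"
proof (rule ccontr)
  assume contra: "\<not> ?thesis"
  have escape: "\<exists>a\<in>banded_contractions r. compress F a = compress F a0 \<and> \<not> approximable e (real n) (Ad a)"
    if "finite F" "a0 \<in> banded_contractions r" for F n a0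
    using contra that by blast
  \<comment> \<open>A step keeps the block on \<open>F\<close>, and enlarges \<open>F\<close> to \<open>F'\<close> such that the new block excludes propagation \<open>n\<close>.\<close>
  define P where "P = (\<lambda>(F :: 'x set, a :: ('x, 'h) ell2 \<Rightarrow>\<^sub>L ('x, 'h) ell2). finite F \<and> a \<in> banded_contractions r)"
  define Q where "Q n = (\<lambda>(F :: 'x set, a) (F', a'). F \<subseteq> F' \<and> compress F a' = compress F a \<and>
    (\<forall>b\<in>banded_contractions r. compress F' b = compress F' a' \<longrightarrow> \<not> approximable e (real n) (Ad b)))" for n
  have step: "\<exists>t'. P t' \<and> Q n t t'" if Pt: "P t" for t n
  proof -
    obtain F a where t: "t = (F, a)" by (cases t)
    with Pt have F: "finite F" and a: "a \<in> banded_contractions r" by (simp_all add: P_def)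
    obtain a' where a': "a' \<in> banded_contractions r" "compress F a' = compress F a"
      and not: "\<not> approximable e (real n) (Ad a')"
      using escape[OF F a] by blast
    have "\<exists>F'. finite F' \<and> (\<forall>b. norm b \<le> 1 \<and> compress F' b = compress F' a' \<longrightarrow> \<not> approximable e (real n) (Ad b))"
    proof (rule ccontr)
      assume none: "\<not> ?thesis"
      have "approximable e (real n) (Ad a')"
      proof (rule approximable_closed)
        show "norm a' \<le> 1" using a'(1) by (simp add: banded_contractions_def)
        show "\<exists>b. norm b \<le> 1 \<and> compress F' b = compress F' a' \<and> approximable e (real n) (Ad b)"
          if "finite F'" for F'
          using none that by blast
      qed (use e in simp_all)
      then show False using not by simp
    qed
    then obtain F' where F': "finite F'"
      "\<And>b. norm b \<le> 1 \<Longrightarrow> compress F' b = compress F' a' \<Longrightarrow> \<not> approximable e (real n) (Ad b)"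
      by blast
    have "\<not> approximable e (real n) (Ad b)"
      if b: "b \<in> banded_contractions r" "compress (F \<union> F') b = compress (F \<union> F') a'" for b
    proof (rule F'(2))
      show "norm b \<le> 1" using b(1) by (simp add: banded_contractions_def)
      have "compress F' (compress (F \<union> F') b) = compress F' (compress (F \<union> F') a')"
        by (simp only: b(2))
      then show "compress F' b = compress F' a'"
        by (simp add: compress_compress Int_absorb2)
    qed
    then have "Q n t (F \<union> F', a')"
      unfolding Q_def t using a'(2) by auto
    moreover have "P (F \<union> F', a')" using F F'(1) a'(1) by (simp add: P_def)
    ultimately show ?thesis by blast
  qed
  have zero: "(0 :: ('x, 'h) ell2 \<Rightarrow>\<^sub>L ('x, 'h) ell2) \<in> banded_contractions r"
  proof -
    have "entry (0 :: ('x, 'h) ell2 \<Rightarrow>\<^sub>L ('x, 'h) ell2) x y = 0" for x y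
      by (rule blinfun_eqI) (simp add: entry_apply zero_ell2.rep_eq)
    then show ?thesis
      by (simp add: banded_contractions_def bounded_operators_def propagation_le_iff[OF r]
          complex_vector.scale_zero_right)
  qed
  have "\<exists>f. \<forall>n. P (f n) \<and> Q n (f n) (f (Suc n))"
  proof (rule dependent_nat_choice)
    show "\<exists>t. P t" using zero by (intro exI[of _ "({}, 0)"]) (simp add: P_def)
  qed (rule step)
  then obtain f where f: "\<And>n. P (f n)" "\<And>n. Q n (f n) (f (Suc n))" by blast
  define F where "F n = fst (f n)" for n
  define a where "a n = snd (f n)" for n
  have F: "finite (F n)" and a: "a n \<in> banded_contractions r" for n
    using f(1)[of n] by (simp_all add: P_def F_def a_def split: prod.splits)
  have F_Suc: "F n \<subseteq> F (Suc n)" and a_Suc: "compress (F n) (a (Suc n)) = compress (F n) (a n)"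
    and avoid: "\<And>b. b \<in> banded_contractions r \<Longrightarrow> compress (F (Suc n)) b = compress (F (Suc n)) (a (Suc n))
      \<Longrightarrow> \<not> approximable e (real n) (Ad b)" for n
    using f(2)[of n] by (auto simp: Q_def F_def a_def split: prod.splits)
  have F_mono: "F m \<subseteq> F n" if "m \<le> n" for m n
    using F_Suc that by (rule lift_Suc_mono_le)
  have coherent: "compress (F n) (a m) = compress (F n) (a n)" if "n \<le> m" for n m
    using that
  proof (induction m rule: dec_induct)
    case (step m)
    have "compress (F n) (compress (F m) (a (Suc m))) = compress (F n) (compress (F m) (a m))"
      by (simp only: a_Suc)
    then show ?case
      using step F_mono[OF step(1)] by (simp add: compress_compress Int_absorb2)
  qed simp
  define c where "c n = compress (F n) (a n)" for n
  have c: "c n \<in> banded_contractions r" for n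
    unfolding c_def by (rule compress_banded_contractions[OF a r])
  then have "\<forall>\<^sub>F n in sequentially. c n \<in> bounded_operators \<and> norm (c n) \<le> 1"
    by (simp add: banded_contractions_def)
  from weak_operator_cluster_point[OF sequentially_bot this]
  obtain G b where G: "G \<le> sequentially" "G \<noteq> bot" and b: "b \<in> bounded_operators" "norm b \<le> 1"
    and lim: "\<And>v w. ((\<lambda>n. cinner (blinfun_apply (c n) v) w) \<longlongrightarrow> cinner (blinfun_apply b v) w) G"
    by blast
  have block: "compress (F n) b = compress (F n) (a n)" for n
  proof (intro blinfun_eqI cinner_ext)
    fix v w
    have "\<forall>\<^sub>F m in sequentially. cinner (c m (cutoff (F n) v)) (cutoff (F n) w) = cinner (compress (F n) (a n) v) w"
      using eventually_ge_at_top[of n]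
    proof eventually_elim
      case (elim m)
      have "compress (F n) (c m) = compress (F n) (a n)"
        using coherent[OF elim] F_mono[OF elim] by (simp add: c_def compress_compress Int_absorb2)
      then have "cinner (compress (F n) (c m) v) w = cinner (compress (F n) (a n) v) w" by simp
      then show ?case by (simp add: compress_apply cinner_cutoff)
    qed
    then have "\<forall>\<^sub>F m in G. cinner (c m (cutoff (F n) v)) (cutoff (F n) w) = cinner (compress (F n) (a n) v) w"
      by (rule filter_leD[OF G(1)])
    then have "((\<lambda>m. cinner (c m (cutoff (F n) v)) (cutoff (F n) w)) \<longlongrightarrow> cinner (compress (F n) (a n) v) w) G"
      by (rule tendsto_eventually)
    then have "cinner (b (cutoff (F n) v)) (cutoff (F n) w) = cinner (compress (F n) (a n) v) w"
      by (rule tendsto_unique[OF G(2) lim])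
    then show "cinner (compress (F n) b v) w = cinner (compress (F n) (a n) v) w"
      by (simp add: compress_apply cinner_cutoff)
  qed
  have b_entry: "(\<exists>n. entry b x y = entry (a n) x y) \<or> entry b x y = 0" for x y
  proof (cases "\<exists>n. x \<in> F n \<and> y \<in> F n")
    case True
    then obtain n where n: "x \<in> F n" "y \<in> F n" by blast
    have "entry (compress (F n) b) x y = entry (compress (F n) (a n)) x y" by (simp only: block)
    then show ?thesis using n by (auto simp: entry_compress)
  next
    case False
    then have "\<forall>\<^sub>F n in G. entry (c n) x y = 0"
      by (intro always_eventually) (auto simp: c_def entry_compress)
    with G(2) lim have "entry b x y = 0" by (rule entry_weak_limit_zero)
    then show ?thesis by simp
  qed
  have "b \<in> banded_contractions r"
  proof -
    have "entry b x y = 0" if "r < dist x y" for x y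
      using b_entry[of x y] a that by (auto simp: banded_contractions_def propagation_le_iff[OF r])
    moreover have "compact_operator (entry b x y)" for x y
      using b_entry[of x y] a by (auto simp: banded_contractions_def)
    ultimately show ?thesis
      using b by (simp add: banded_contractions_def propagation_le_iff[OF r])
  qed
  then have not: "\<not> approximable e (real n) (Ad b)" for n
    using avoid block by blast
  have "Ad b \<in> roe_algebra"
    by (intro Ad_roe_algebra banded_contractions_roe_algebra) fact
  then obtain d s where d: "d \<in> bounded_operators" "0 \<le> s" "propagation d \<le> ennreal s" "norm (Ad b - d) < e"
    using roe_algebra_approx[OF _ e] by blast
  obtain n where "s \<le> real n" using real_arch_simple by blast
  then have "propagation d \<le> ennreal (real n)"
    using d(3) by (meson ennreal_leI order_trans)
  then have "approximable e (real n) (Ad b)"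
    unfolding approximable_def using d(1,4) less_imp_le by blast
  then show False using not by blast
qed

end


section \<open>Uniform approximation\<close>

context roe_unitary
begin

text \<open>The operator \<open>Ad k\<close> factors through \<open>U\<close> and \<open>V\<close> restricted to \<open>G\<close>, and by tightness these are nearly
  concentrated on one finite set \<open>F\<close>. So the compression of \<open>Ad k\<close> to \<open>F\<close> approximates it, with a propagation
  that does not depend on \<open>k\<close>. The bound 2 on the norm is that of the difference of two contractions.\<close>

lemma approximable_finite_block:
  assumes ulf: "uniformly_locally_finite TYPE('x)" and e: "e > 0" and G: "finite G"
  shows "\<exists>s\<ge>0. \<forall>k\<in>bounded_operators. norm k \<le> 2 \<and> compress G k = k \<longrightarrow> approximable (4 * e) s (Ad k)"
proof -
  obtain F where F: "finite F" "norm (cutoff (- F) o\<^sub>L U o\<^sub>L cutoff G) \<le> e" "norm (cutoff G o\<^sub>L V o\<^sub>L cutoff (- F)) \<le> e"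
    using tight[OF ulf e G] by blast
  obtain s where s: "0 \<le> s"
    "\<And>a :: ('y, 'h) ell2 \<Rightarrow>\<^sub>L ('y, 'h) ell2. propagation (compress F a) \<le> ennreal s"
    using propagation_compress_finite[OF F(1)] by blast
  have "approximable (4 * e) s (Ad k)"
    if k: "k \<in> bounded_operators" "norm k \<le> 2" "compress G k = k" for k
  proof -
    have kG: "k v = cutoff G (k (cutoff G v))" for v
      using k(3) by (metis compress_apply)
    define t1 where "t1 = (cutoff (- F) o\<^sub>L U o\<^sub>L cutoff G) o\<^sub>L (k o\<^sub>L V)"
    define t2 where "t2 = (cutoff F o\<^sub>L U o\<^sub>L k) o\<^sub>L (cutoff G o\<^sub>L V o\<^sub>L cutoff (- F))"
    have GG: "cutoff G (cutoff G v) = cutoff G v" for v :: "('x, 'h) ell2"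
      by (simp add: cutoff_cutoff)
    have Gk: "cutoff G (k v) = k v" for v
    proof -
      have "cutoff G (k v) = cutoff G (cutoff G (k (cutoff G v)))" by (rule arg_cong[OF kG])
      also have "\<dots> = k v" unfolding GG by (rule kG[symmetric])
      finally show ?thesis .
    qed
    have kG': "k (cutoff G v) = k v" for v
    proof -
      have "k (cutoff G v) = cutoff G (k (cutoff G (cutoff G v)))" by (rule kG)
      also have "\<dots> = k v" unfolding GG by (rule kG[symmetric])
      finally show ?thesis .
    qed
    have "Ad k - compress F (Ad k) = t1 + t2"
    proof (rule blinfun_eqI)
      fix w
      have "Ad k w - compress F (Ad k) w
          = cutoff (- F) (Ad k w) + cutoff F (Ad k (w - cutoff F w))"
        by (simp add: compress_apply blinfun.diff_right cutoff_Compl)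
      then show "(Ad k - compress F (Ad k)) w = (t1 + t2) w"
        by (simp add: t1_def t2_def Ad_apply blinfun.diff_left blinfun.add_left Gk kG' flip: cutoff_Compl)
    qed
    moreover have "norm t1 \<le> e * (2 * 1)"
      unfolding t1_def by (intro norm_blinfun_compose_le F k norm_V_le)
    moreover have "norm t2 \<le> (1 * 1 * 2) * e"
      unfolding t2_def by (intro norm_blinfun_compose_le F k norm_U_le norm_cutoff)
    ultimately have "norm (Ad k - compress F (Ad k)) \<le> 4 * e"
      using norm_triangle_ineq[of t1 t2] by simp
    then show ?thesis
      unfolding approximable_def
      using s(2) compress_bounded_operators[OF Ad_bounded_operators[OF k(1)]] by blast
  qed
  with s(1) show ?thesis by blast
qed

text \<open>Let \<open>F\<close> and \<open>a0\<close> be as in the category argument. The block of \<open>a\<close> off \<open>F\<close> is the difference of two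
  contractions that agree with \<open>a0\<close> on \<open>F\<close>. What remains of \<open>a\<close> lives on the finite set of points at
  distance at most \<open>r\<close> from \<open>F\<close>, where tightness applies.\<close>

lemma uniformly_approximable:
  assumes ulf: "uniformly_locally_finite TYPE('x)" and e: "e > 0" and r: "r > 0"
  shows "\<exists>s\<ge>0. \<forall>a\<in>banded_contractions r. approximable (6 * e) s (Ad a)"
proof -
  have r0: "0 \<le> r" using r by simp
  obtain F n a0 where F: "finite F" and a0: "a0 \<in> banded_contractions r"
    and int: "\<And>a. a \<in> banded_contractions r \<Longrightarrow> compress F a = compress F a0 \<Longrightarrow> approximable e (real n) (Ad a)"
    using approximable_interior[OF r0 e] by blast
  define G where "G = F \<union> (\<Union>x\<in>F. cball x r)"
  have "finite (cball x r)" for x :: 'x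
    using ulf r unfolding uniformly_locally_finite_def by blast
  then have G: "finite G" using F by (simp add: G_def)
  obtain s where s: "0 \<le> s" and block: "\<And>k. k \<in> bounded_operators \<Longrightarrow> norm k \<le> 2 \<Longrightarrow> compress G k = k
      \<Longrightarrow> approximable (4 * e) s (Ad k)"
    using approximable_finite_block[OF ulf e G] by blast
  have "approximable (6 * e) (max (real n) s) (Ad a)" if a: "a \<in> banded_contractions r" for a
  proof -
    define d where "d = compress (- F) a"
    have zero: "compress F d = 0"
      unfolding d_def compress_compress by (rule blinfun_eqI, rule ell2_eqI)
        (simp add: compress_apply cutoff_apply zero_ell2.rep_eq)
    have FF: "compress F (compress F a0) = compress F a0" by (simp add: compress_compress)
    have "approximable e (real n) (Ad (compress F a0 + d))"
    proof (rule int)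
      show "compress F a0 + d \<in> banded_contractions r"
        unfolding d_def by (rule glue_banded_contractions[OF a0 a r0])
      have "compress F (compress F a0 + d) = compress F (compress F a0) + compress F d"
        by (rule blinfun_eqI) (simp add: compress_apply blinfun.add_left blinfun.add_right)
      then show "compress F (compress F a0 + d) = compress F a0" by (simp add: zero FF)
    qed
    moreover have "approximable e (real n) (Ad (compress F a0))"
      by (rule int[OF compress_banded_contractions[OF a0 r0] FF])
    ultimately have "approximable (2 * e) (real n) (Ad (compress F a0 + d) - Ad (compress F a0))"
      by (rule approximable_diff) simp
    then have d_approx: "approximable (2 * e) (real n) (Ad d)" by (simp add: Ad_add)
    have d_in: "d \<in> banded_contractions r"
      unfolding d_def by (rule compress_banded_contractions[OF a r0])
    have "approximable (4 * e) s (Ad (a - d))"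
    proof (rule block)
      show "a - d \<in> bounded_operators"
        using a d_in by (intro bounded_operators_diff) (simp_all add: banded_contractions_def)
      show "norm (a - d) \<le> 2"
        using a d_in norm_triangle_ineq4[of a d] by (simp add: banded_contractions_def)
      show "compress G (a - d) = a - d"
      proof (rule entry_eqI)
        fix x y
        have a_far: "entry a x y = 0" if "r < dist x y"
          using a that by (simp add: banded_contractions_def propagation_le_iff[OF r0])
        have "entry (a - d) x y = 0" if "\<not> (x \<in> G \<and> y \<in> G)"
        proof (cases "x \<in> F \<or> y \<in> F")
          case True
          then have "r < dist x y"
            using that by (auto simp: G_def dist_commute not_le[symmetric])
          then show ?thesis by (simp add: entry_diff d_def entry_compress a_far)
        qed (simp add: entry_diff d_def entry_compress)
        then show "entry (compress G (a - d)) x y = entry (a - d) x y"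
          by (simp add: entry_compress)
      qed
    qed
    from approximable_add[OF d_approx this] s
    have "approximable (2 * e + 4 * e) (max (real n) s) (Ad d + Ad (a - d))" by simp
    then show ?thesis by (simp add: Ad_diff)
  qed
  then show ?thesis using s by (intro exI[of _ "max (real n) s"]) auto
qed

end

theorem theorem3p4:
  fixes \<Phi> :: "(('x::metric_space, 'h::chilbert_space) ell2 \<Rightarrow>\<^sub>L ('x, 'h) ell2) \<Rightarrow>
      (('y::metric_space, 'h) ell2 \<Rightarrow>\<^sub>L ('y, 'h) ell2)"
  assumes "separable_space (euclidean :: 'h topology)"
    and "infinite_dimensional TYPE('h)"
    and "uniformly_locally_finite TYPE('x)"
    and "uniformly_locally_finite TYPE('y)"
    and "star_isomorphism roe_algebra roe_algebra \<Phi>"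
  shows "coarse_like \<Phi>"
proof -
  have "\<exists>h :: 'h. h \<noteq> 0"
  proof (rule ccontr)
    assume "\<not> ?thesis"
    then have "(UNIV :: 'h set) = {0}" by auto
    then have "complex_vector.span {} = (UNIV :: 'h set)"
      by (simp add: complex_vector.span_empty)
    then show False
      using assms(2) unfolding infinite_dimensional_def by blast
  qed
  then obtain h :: 'h where "h \<noteq> 0" by blast
  from star_isomorphism_unitary[OF assms(5) this]
  obtain U V where UV: "roe_unitary U V"
    and \<Phi>: "\<And>a. a \<in> roe_algebra \<Longrightarrow> \<Phi> a = U o\<^sub>L a o\<^sub>L V" by blast
  interpret roe_unitary U V by (rule UV)
  show ?thesis
    unfolding coarse_like_def
  proof (intro allI impI)
    fix \<epsilon> r :: real
    assume "\<epsilon> > 0" "r > 0"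
    \<comment> \<open>The approximation loses a factor 6, and making the entries of the approximant compact a factor 3.\<close>
    then have "\<epsilon> / 18 > 0" by simp
    then obtain s where s: "0 \<le> s" "\<And>a. a \<in> banded_contractions r \<Longrightarrow> approximable (6 * (\<epsilon> / 18)) s (Ad a)"
      using uniformly_approximable[OF assms(3) _ \<open>r > 0\<close>] by blast
    have "\<exists>c\<in>roe_algebra. propagation c \<le> ennreal (s + 1) \<and> norm (\<Phi> a - c) \<le> \<epsilon>"
      if a: "a \<in> roe_algebra" "norm a \<le> 1" "propagation a \<le> ennreal r" for a
    proof -
      have "a \<in> banded_contractions r"
        using a roe_algebra_bounded_operators[OF a(1)] by (simp add: banded_contractions_def roe_algebra_def)
      then obtain c where c: "c \<in> bounded_operators" "propagation c \<le> ennreal s" "norm (Ad a - c) \<le> \<epsilon> / 3"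
        using s(2) unfolding approximable_def by fastforce
      have "0 < \<epsilon> / 3" using \<open>\<epsilon> > 0\<close> by simp
      then obtain c' where c': "c' \<in> roe_algebra" "propagation c' \<le> ennreal s" "norm (Ad a - c') \<le> 3 * (\<epsilon> / 3)"
        using approximant_in_roe_algebra[OF assms(4) Ad_roe_algebra[OF a(1)] norm_Ad[OF a(2)] c s(1)] by blast
      have "ennreal s \<le> ennreal (s + 1)" by (rule ennreal_leI) simp
      with c'(2) have "propagation c' \<le> ennreal (s + 1)" by (rule order_trans)
      moreover have "norm (\<Phi> a - c') \<le> \<epsilon>"
        using c'(3) by (simp add: \<Phi>[OF a(1)] Ad_def)
      ultimately show ?thesis using c'(1) by blast
    qed
    then show "\<exists>s>0. \<forall>a\<in>roe_algebra. norm a \<le> 1 \<and> propagation a \<le> ennreal r \<longrightarrow>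
        (\<exists>c\<in>roe_algebra. propagation c \<le> ennreal s \<and> norm (\<Phi> a - c) \<le> \<epsilon>)"
      using s(1) by (intro exI[of _ "s + 1"]) auto
  qed
qed

end
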